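(* Let $f(\boldsymbol x,\boldsymbol y)=\boldsymbol x^{\top}\boldsymbol M\boldsymbol y+\boldsymbol b^{\top}\boldsymbol x-\boldsymbol c^{\top}\boldsymbol y$ on $\mathbb R^m\times\mathbb R^n$, and let $(\boldsymbol x_t,\boldsymbol y_t)_{t=1}^T$ be the iterates of the algorithm COGDA described in the context, run with step sizes $\eta_x,\eta_y>0$, initial point $(\boldsymbol x_1,\boldsymbol y_1)\in\mathbb R^m\times\mathbb R^n$ and regularization parameters $\varrho_y=4\eta_xL_M^2$ and $\varrho_x=4\eta_yL_M^2$, with stochastic gradients obeying the noise model in the context. Then for every adaptive comparator $(\boldsymbol x^*,\boldsymbol y^* )\in\mathbb R^m\times\mathbb R^n$ (a random pair that may depend on the whole history $\mathcal F_T$), the duality gap $G(\boldsymbol x^*,\boldsymbol y^* )=f(\overline{\boldsymbol x}_T,\boldsymbol y^* )-f(\boldsymbol x^*,\overline{\boldsymbol y}_T)$ satisfies $$\begin{aligned}\mathbb E[G(\boldsymbol x^*,\boldsymbol y^* )]\le{}&\Big(\frac1{\eta_yT}+2\eta_xL_M^2\Big)\mathbb E\big[\|\boldsymbol y^*-\boldsymbol y_1\|_2^2\big]+\Big(\frac1{\eta_xT}+2\eta_yL_M^2\Big)\mathbb E\big[\|\boldsymbol x^*-\boldsymbol x_1\|_2^2\big]\\&+\frac{2\eta_y}{T}\sum_{t=1}^T\mathbb E\big[\|\widehat{\boldsymbol M}(t)^{\top}\boldsymbol x_1-\widehat{\boldsymbol c}(t)\|_2^2\big]+\frac{2\eta_x}{T}\sum_{t=1}^T\mathbb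 E\big[\|\widehat{\boldsymbol M}(t)\boldsymbol y_1+\widehat{\boldsymbol b}(t)\|_2^2\big].\end{aligned}$$ In particular, there is an absolute constant $C$ such that, with $\boldsymbol x_1=0$, $\boldsymbol y_1=0$ and $\eta_x=\eta_y=\frac{1}{L_M\sqrt{2T}}$, $$\mathbb E[G(\boldsymbol x^*,\boldsymbol y^* )]\le C\,\frac{L_M^2\,\mathbb E\big[\|\boldsymbol y^*\|_2^2+\|\boldsymbol x^*\|_2^2\big]+L_b^2+L_c^2}{L_M\sqrt T}.$$
   Context: **Problem.** $\boldsymbol M\in\mathbb R^{m\times n}$, $\boldsymbol b\in\mathbb R^m$, $\boldsymbol c\in\mathbb R^n$ are fixed, $T\ge1$ is an integer. **Noise model.** In each round $t=1,\dots,T$ one observes $\widehat{\boldsymbol M}(t)=\boldsymbol M+\boldsymbol\xi_M(t)$, $\widehat{\boldsymbol b}(t)=\boldsymbol b+\boldsymbol\xi_b(t)$, $\widehat{\boldsymbol c}(t)=\boldsymbol c+\boldsymbol\xi_c(t)$, where the noise triples $(\boldsymbol\xi_M(t),\boldsymbol\xi_b(t),\boldsymbol\xi_c(t))$ are i.i.d. over $t$ and zero-mean. $\mathcal F_t$ is the $\sigma$-algebra generated by all observations in rounds $1,\dots,t$, and $\mathbb E_t[\cdot]=\mathbb E[\cdot\mid\mathcal F_{t-1}]$. There are constants $L_M,L_b,L_c>0$ such that for all $t$ and all $\boldsymbol x\in\mathbb R^m$, $\boldsymbol y\in\mathbb R^n$: $\mathbb E_t[\|\widehat{\boldsymbol M}(t)\boldsymbol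 y\|_2^2]\le L_M^2\|\boldsymbol y\|_2^2$, $\mathbb E_t[\|\widehat{\boldsymbol M}(t)^{\top}\boldsymbol x\|_2^2]\le L_M^2\|\boldsymbol x\|_2^2$, $\mathbb E_t[\|\widehat{\boldsymbol b}(t)\|_2^2]\le L_b^2$, $\mathbb E_t[\|\widehat{\boldsymbol c}(t)\|_2^2]\le L_c^2$. **Algorithm COGDA.** The stochastic gradients are $\widetilde{\boldsymbol g}_x(t)=\widehat{\boldsymbol M}(t)\boldsymbol y_t+\widehat{\boldsymbol b}(t)$ and $\widetilde{\boldsymbol g}_y(t)=\widehat{\boldsymbol M}(t)^{\top}\boldsymbol x_t-\widehat{\boldsymbol c}(t)$. Starting from a deterministic point $(\boldsymbol x_1,\boldsymbol y_1)$, for $t=1,2,\dots$, $$\boldsymbol x_{t+1}=\frac{\boldsymbol x_t-\eta_x\widetilde{\boldsymbol g}_x(t)+\varrho_x\eta_x\boldsymbol x_1}{1+\varrho_x\eta_x},\qquad \boldsymbol y_{t+1}=\frac{\boldsymbol y_t+\eta_y\widetilde{\boldsymbol g}_y(t)+\varrho_y\eta_y\boldsymbol y_1}{1+\varrho_y\eta_y}.$$ The output is $\overline{\boldsymbol x}_T=\frac1T\sum_{t=1}^T\boldsymbol x_t$, $\overline{\boldsymbol y}_T=\frac1T\sum_{t=1}^T\boldsymbol y_t$. **Convention.** Comparators are random vectors for which the expectations $\mathbb E\|\boldsymbol x^*-\boldsymbol x_1\|_2^2$ and $\mathbb E\|\boldsymbol y^*-\boldsymbol y_1\|_2^2$ are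 finite. *)

theory Defs
  imports "HOL-Probability.Probability"
begin

text \<open>
  Vectors are elements of \<open>real ^ 'm\<close> and \<open>real ^ 'n\<close>, whose \<open>norm\<close> is the Euclidean norm;
  an \<open>m \<times> n\<close> matrix has type \<open>real ^ 'n ^ 'm\<close>.  Rounds are numbered from 1.
\<close>

definition history :: "'w measure \<Rightarrow> (nat \<Rightarrow> 'w \<Rightarrow> 'a::topological_space) \<Rightarrow> nat \<Rightarrow> 'w measure" where
  "history P X t =
     sigma (space P) (\<Union>s\<in>{1..t}. {X s -` A \<inter> space P | A. A \<in> sets borel})"

text \<open>
  The conditional second moments are taken with \<open>nn_cond_exp\<close>, valued in \<open>[0, \<infinity>]\<close>:
  \<open>real_cond_exp\<close> would return 0 where the conditional expectation is infinite, and the bounds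
  would then hold vacuously.
\<close>

locale cogda_noise = prob_space P
  for P :: "'w measure" +
  fixes T :: nat
    and M :: "real ^ 'n ^ 'm" and b :: "real ^ 'm" and c :: "real ^ 'n"
    and \<xi>M :: "nat \<Rightarrow> 'w \<Rightarrow> real ^ 'n ^ 'm"
    and \<xi>b :: "nat \<Rightarrow> 'w \<Rightarrow> real ^ 'm"
    and \<xi>c :: "nat \<Rightarrow> 'w \<Rightarrow> real ^ 'n"
    and Mh :: "nat \<Rightarrow> 'w \<Rightarrow> real ^ 'n ^ 'm"
    and bh :: "nat \<Rightarrow> 'w \<Rightarrow> real ^ 'm"
    and ch :: "nat \<Rightarrow> 'w \<Rightarrow> real ^ 'n"
    and LM Lb Lc :: real
  assumes obs_M: "\<And>t \<omega>. t \<in> {1..T} \<Longrightarrow> Mh t \<omega> = M + \<xi>M t \<omega>"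
    and obs_b: "\<And>t \<omega>. t \<in> {1..T} \<Longrightarrow> bh t \<omega> = b + \<xi>b t \<omega>"
    and obs_c: "\<And>t \<omega>. t \<in> {1..T} \<Longrightarrow> ch t \<omega> = c + \<xi>c t \<omega>"
    and noise_indep: "indep_vars (\<lambda>_. borel) (\<lambda>t \<omega>. (\<xi>M t \<omega>, \<xi>b t \<omega>, \<xi>c t \<omega>)) {1..T}"
    and noise_ident: "\<And>s t. s \<in> {1..T} \<Longrightarrow> t \<in> {1..T} \<Longrightarrow>
          distr P borel (\<lambda>\<omega>. (\<xi>M s \<omega>, \<xi>b s \<omega>, \<xi>c s \<omega>))
        = distr P borel (\<lambda>\<omega>. (\<xi>M t \<omega>, \<xi>b t \<omega>, \<xi>c t \<omega>))"
    and noise_mean_M: "\<And>t. t \<in> {1..T} \<Longrightarrow> has_bochner_integral P (\<xi>M t) 0"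
    and noise_mean_b: "\<And>t. t \<in> {1..T} \<Longrightarrow> has_bochner_integral P (\<xi>b t) 0"
    and noise_mean_c: "\<And>t. t \<in> {1..T} \<Longrightarrow> has_bochner_integral P (\<xi>c t) 0"
    and LM_pos: "LM > 0" and Lb_pos: "Lb > 0" and Lc_pos: "Lc > 0"
    and moment_M: "\<And>t y. t \<in> {1..T} \<Longrightarrow>
          AE \<omega> in P. nn_cond_exp P (history P (\<lambda>s \<omega>. (Mh s \<omega>, bh s \<omega>, ch s \<omega>)) (t - 1))
                       (\<lambda>\<omega>. ennreal ((norm (Mh t \<omega> *v y))\<^sup>2)) \<omega>
                     \<le> ennreal (LM\<^sup>2 * (norm y)\<^sup>2)"
    and moment_Mt: "\<And>t x. t \<in> {1..T} \<Longrightarrow>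
          AE \<omega> in P. nn_cond_exp P (history P (\<lambda>s \<omega>. (Mh s \<omega>, bh s \<omega>, ch s \<omega>)) (t - 1))
                       (\<lambda>\<omega>. ennreal ((norm (transpose (Mh t \<omega>) *v x))\<^sup>2)) \<omega>
                     \<le> ennreal (LM\<^sup>2 * (norm x)\<^sup>2)"
    and moment_b: "\<And>t. t \<in> {1..T} \<Longrightarrow>
          AE \<omega> in P. nn_cond_exp P (history P (\<lambda>s \<omega>. (Mh s \<omega>, bh s \<omega>, ch s \<omega>)) (t - 1))
                       (\<lambda>\<omega>. ennreal ((norm (bh t \<omega>))\<^sup>2)) \<omega>
                     \<le> ennreal (Lb\<^sup>2)"
    and moment_c: "\<And>t. t \<in> {1..T} \<Longrightarrow>
          AE \<omega> in P. nn_cond_exp P (history P (\<lambda>s \<omega>. (Mh s \<omega>, bh s \<omega>, ch s \<omega>)) (t - 1))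
                       (\<lambda>\<omega>. ennreal ((norm (ch t \<omega>))\<^sup>2)) \<omega>
                     \<le> ennreal (Lc\<^sup>2)"

text \<open>
  The iteration is a deterministic function of the observed sequence; the random iterates are
  obtained by applying it to each realization.  The value at index 0 is not used.
\<close>

fun cogda ::
  "real \<Rightarrow> real \<Rightarrow> real \<Rightarrow> real \<Rightarrow> real ^ 'm \<Rightarrow> real ^ 'n \<Rightarrow>
   (nat \<Rightarrow> real ^ 'n ^ 'm) \<Rightarrow> (nat \<Rightarrow> real ^ 'm) \<Rightarrow> (nat \<Rightarrow> real ^ 'n) \<Rightarrow>
   nat \<Rightarrow> (real ^ 'm) \<times> (real ^ 'n)" where
  "cogda \<eta>x \<eta>y \<rho>x \<rho>y x1 y1 A p q 0 = (x1, y1)"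
| "cogda \<eta>x \<eta>y \<rho>x \<rho>y x1 y1 A p q (Suc 0) = (x1, y1)"
| "cogda \<eta>x \<eta>y \<rho>x \<rho>y x1 y1 A p q (Suc (Suc k)) =
     (let t = Suc k;
          (x, y) = cogda \<eta>x \<eta>y \<rho>x \<rho>y x1 y1 A p q t;
          gx = A t *v y + p t;
          gy = transpose (A t) *v x - q t
      in ((x - \<eta>x *\<^sub>R gx + (\<rho>x * \<eta>x) *\<^sub>R x1) /\<^sub>R (1 + \<rho>x * \<eta>x),
          (y + \<eta>y *\<^sub>R gy + (\<rho>y * \<eta>y) *\<^sub>R y1) /\<^sub>R (1 + \<rho>y * \<eta>y)))"

definition cogda_xbar where
  "cogda_xbar \<eta>x \<eta>y \<rho>x \<rho>y x1 y1 A p q T =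
     (\<Sum>t=1..T. fst (cogda \<eta>x \<eta>y \<rho>x \<rho>y x1 y1 A p q t)) /\<^sub>R real T"

definition cogda_ybar where
  "cogda_ybar \<eta>x \<eta>y \<rho>x \<rho>y x1 y1 A p q T =
     (\<Sum>t=1..T. snd (cogda \<eta>x \<eta>y \<rho>x \<rho>y x1 y1 A p q t)) /\<^sub>R real T"

definition saddle_f ::
  "real ^ 'n ^ 'm \<Rightarrow> real ^ 'm \<Rightarrow> real ^ 'n \<Rightarrow> real ^ 'm \<Rightarrow> real ^ 'n \<Rightarrow> real" where
  "saddle_f M b c x y = x \<bullet> (M *v y) + b \<bullet> x - c \<bullet> y"

text \<open>The gap of the averaged iterates along one realization \<open>A, p, q\<close> of the observations.\<close>

definition cogda_gap where
  "cogda_gap M b c \<eta>x \<eta>y \<rho>x \<rho>y x1 y1 A p q T xs ys =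
     saddle_f M b c (cogda_xbar \<eta>x \<eta>y \<rho>x \<rho>y x1 y1 A p q T) ys
   - saddle_f M b c xs (cogda_ybar \<eta>x \<eta>y \<rho>x \<rho>y x1 y1 A p q T)"

text \<open>
  An adaptive comparator is any pair of random vectors with finite second moments around the
  initial point.  It may depend on all observations; it is not required to be independent of
  them, nor to be measurable with respect to them.
\<close>

definition adaptive_comparator ::
  "'w measure \<Rightarrow> real ^ 'm \<Rightarrow> real ^ 'n \<Rightarrow> ('w \<Rightarrow> real ^ 'm) \<Rightarrow> ('w \<Rightarrow> real ^ 'n) \<Rightarrow> bool" where
  "adaptive_comparator P x1 y1 xs ys \<longleftrightarrow>
     xs \<in> borel_measurable P \<and> ys \<in> borel_measurable P \<and>
     integrable P (\<lambda>\<omega>. (norm (xs \<omega> - x1))\<^sup>2) \<and> integrable P (\<lambda>\<omega>. (norm (ys \<omega> - y1))\<^sup>2)"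

end

theory Submission
  imports Defs
begin

text \<open>
  Along each realization the anchored gradient steps give the usual online regret bound against an
  arbitrary comparator, plus a negative anchoring term \<open>- (\<rho> / 2) \<Sum> \<parallel>u\<^sub>t - u\<^sub>1\<parallel>\<^sup>2\<close>.  Passing from stochastic
  to exact gradients costs the inner product of the accumulated noise \<open>S\<close> with \<open>w - u\<^sub>1\<close>.  Since the
  comparator \<open>w\<close> may depend on the noise this does not vanish in expectation; Young's inequality bounds
  it by \<open>(\<eta> / 2) \<parallel>S\<parallel>\<^sup>2 + \<parallel>w - u\<^sub>1\<parallel>\<^sup>2 / (2 \<eta>)\<close>, and orthogonality of the martingale increments bounds
  \<open>E \<parallel>S\<parallel>\<^sup>2\<close> by the sum of the second moments of the stochastic gradients.  Those of one player grow with
  the distance of the other player's iterate from its starting point, and the choice of \<open>\<rho>\<^sub>x\<close> and \<open>\<rho>\<^sub>y\<close>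
  makes the anchoring terms cancel exactly this growth.
\<close>

subsection \<open>Square-integrable random vectors\<close>

text \<open>Membership in \<open>L^2(P)\<close>. A non-integrable function has Bochner integral 0,
  so linearity and monotonicity of expectations require integrability at every step. This class
  supplies it: it is closed under the linear operations below, and inner products of its members are
  integrable.\<close>

definition square_integrable :: "'w measure \<Rightarrow> ('w \<Rightarrow> 'a::euclidean_space) \<Rightarrow> bool" where
  "square_integrable P f \<longleftrightarrow> f \<in> borel_measurable P \<and> integrable P (\<lambda>\<omega>. (norm (f \<omega>))\<^sup>2)"

lemma square_integrable_integrable:
  "square_integrable P f \<Longrightarrow> integrable P (\<lambda>\<omega>. (norm (f \<omega>))\<^sup>2)"
  by (simp add: square_integrable_def)

lemma square_integrable_dominated:
  assumes "square_integrable P f" "g \<in> borel_measurable P" "\<And>\<omega>. norm (g \<omega>) \<le> K * norm (f \<omega>)"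
  shows "square_integrable P g"
proof -
  have [measurable]: "g \<in> borel_measurable P" by fact
  have "integrable P (\<lambda>\<omega>. (norm (g \<omega>))\<^sup>2)"
  proof (rule Bochner_Integration.integrable_bound)
    show "integrable P (\<lambda>\<omega>. K\<^sup>2 * (norm (f \<omega>))\<^sup>2)"
      using assms(1) by (simp add: square_integrable_def)
    have "(norm (g \<omega>))\<^sup>2 \<le> K\<^sup>2 * (norm (f \<omega>))\<^sup>2" for \<omega>
      using power_mono[OF assms(3), of \<omega> 2] by (simp add: power_mult_distrib)
    then show "AE \<omega> in P. norm ((norm (g \<omega>))\<^sup>2) \<le> norm (K\<^sup>2 * (norm (f \<omega>))\<^sup>2)"
      by simp
  qed measurable
  then show ?thesis by (simp add: square_integrable_def assms)
qed

text \<open>The right side exceeds the left by exactly \<open>(norm (x - y))\<^sup>2\<close>. The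
  factor 2 here is what later becomes the factor 4 in \<rho>x and \<rho>y.\<close>

lemma norm_add_square_le:
  fixes x y :: "'a::real_inner"
  shows "(norm (x + y))\<^sup>2 \<le> 2 * (norm x)\<^sup>2 + 2 * (norm y)\<^sup>2"
proof -
  have "0 \<le> (norm (x - y))\<^sup>2" by simp
  then show ?thesis
    by (simp add: power2_norm_eq_inner inner_add inner_diff inner_commute)
qed

lemma square_integrable_add:
  assumes "square_integrable P f" "square_integrable P g"
  shows "square_integrable P (\<lambda>\<omega>. f \<omega> + g \<omega>)"
proof -
  have [measurable]: "f \<in> borel_measurable P" "g \<in> borel_measurable P"
    using assms by (simp_all add: square_integrable_def)
  have "integrable P (\<lambda>\<omega>. (norm (f \<omega> + g \<omega>))\<^sup>2)"
  proof (rule Bochner_Integration.integrable_bound)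
    show "integrable P (\<lambda>\<omega>. 2 * (norm (f \<omega>))\<^sup>2 + 2 * (norm (g \<omega>))\<^sup>2)"
      using assms by (simp add: square_integrable_def)
    show "AE \<omega> in P. norm ((norm (f \<omega> + g \<omega>))\<^sup>2) \<le> norm (2 * (norm (f \<omega>))\<^sup>2 + 2 * (norm (g \<omega>))\<^sup>2)"
      using norm_add_square_le[of "f _" "g _"] by simp
  qed measurable
  then show ?thesis by (simp add: square_integrable_def)
qed

lemma square_integrable_scaleR:
  assumes "square_integrable P f"
  shows "square_integrable P (\<lambda>\<omega>. a *\<^sub>R f \<omega>)"
  using assms by (intro square_integrable_dominated[OF assms, of _ "\<bar>a\<bar>"]) (auto simp: square_integrable_def)

lemma square_integrable_uminus:
  assumes "square_integrable P f"
  shows "square_integrable P (\<lambda>\<omega>. - f \<omega>)"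
  using square_integrable_scaleR[OF assms, of "-1"] by simp

lemma square_integrable_diff:
  assumes "square_integrable P f" "square_integrable P g"
  shows "square_integrable P (\<lambda>\<omega>. f \<omega> - g \<omega>)"
  using square_integrable_add[OF assms(1) square_integrable_uminus[OF assms(2)]] by simp

lemma (in prob_space) square_integrable_const: "square_integrable M (\<lambda>_. a)"
  by (simp add: square_integrable_def)

lemma (in prob_space) square_integrable_sum:
  "(\<And>i. i \<in> I \<Longrightarrow> square_integrable M (f i)) \<Longrightarrow> square_integrable M (\<lambda>\<omega>. \<Sum>i\<in>I. f i \<omega>)"
  by (induction I rule: infinite_finite_induct)
    (simp_all add: square_integrable_const square_integrable_add)

lemma square_integrable_bounded_linear:
  assumes "square_integrable P f" "bounded_linear L"
  shows "square_integrable P (\<lambda>\<omega>. L (f \<omega>))"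
proof -
  interpret bounded_linear L by fact
  obtain K where "\<And>x. norm (L x) \<le> norm x * K" using bounded by blast
  moreover have [measurable]: "L \<in> borel_measurable borel" "f \<in> borel_measurable P"
    using assms by (auto simp: square_integrable_def intro: borel_measurable_continuous_onI linear_continuous_on)
  ultimately show ?thesis
    by (intro square_integrable_dominated[OF assms(1), of _ K]) (simp_all add: mult.commute)
qed

lemma square_integrable_inner:
  assumes "square_integrable P f" "square_integrable P g"
  shows "integrable P (\<lambda>\<omega>. f \<omega> \<bullet> g \<omega>)"
proof -
  have [measurable]: "f \<in> borel_measurable P" "g \<in> borel_measurable P"
    using assms by (simp_all add: square_integrable_def)
  show ?thesis
  proof (rule Bochner_Integration.integrable_bound)
    show "integrable P (\<lambda>\<omega>. (norm (f \<omega>))\<^sup>2 + (norm (g \<omega>))\<^sup>2)"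
      using assms by (simp add: square_integrable_def)
    have "\<bar>f \<omega> \<bullet> g \<omega>\<bar> \<le> (norm (f \<omega>))\<^sup>2 + (norm (g \<omega>))\<^sup>2" for \<omega>
    proof -
      have "\<bar>f \<omega> \<bullet> g \<omega>\<bar> \<le> norm (f \<omega>) * norm (g \<omega>)" by (rule Cauchy_Schwarz_ineq2)
      \<comment> \<open>Young gives the bound for twice the product; the product is nonnegative, so
        it is at most its double.\<close>
      also have "\<dots> \<le> (norm (f \<omega>))\<^sup>2 + (norm (g \<omega>))\<^sup>2"
        using sum_squares_bound[of "norm (f \<omega>)" "norm (g \<omega>)"]
          mult_nonneg_nonneg[OF norm_ge_zero norm_ge_zero, of "f \<omega>" "g \<omega>"]
        unfolding mult.assoc by linarith
      finally show ?thesis .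
    qed
    then show "AE \<omega> in P. norm (f \<omega> \<bullet> g \<omega>) \<le> norm ((norm (f \<omega>))\<^sup>2 + (norm (g \<omega>))\<^sup>2)"
      by simp
  qed measurable
qed

text \<open>The noise model bounds \<open>[0, \<infinity>]\<close>-valued integrals. A finite bound
  first yields integrability, and then the same bound for the real integral. The sign of
  \<open>K\<close> matters because \<open>ennreal\<close> sends negative reals to 0.\<close>

lemma square_integrable_nn_integral_le:
  assumes [measurable]: "f \<in> borel_measurable P"
    and le: "(\<integral>\<^sup>+\<omega>. ennreal ((norm (f \<omega>))\<^sup>2) \<partial>P) \<le> ennreal K" and "K \<ge> 0"
  shows "square_integrable P f" "(\<integral>\<omega>. (norm (f \<omega>))\<^sup>2 \<partial>P) \<le> K"
proof -
  have "(\<integral>\<^sup>+\<omega>. ennreal ((norm (f \<omega>))\<^sup>2) \<partial>P) < \<infinity>"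
    using le by (simp add: order.strict_trans1)
  then have int: "integrable P (\<lambda>\<omega>. (norm (f \<omega>))\<^sup>2)"
    by (intro integrableI_bounded) simp_all
  then show "square_integrable P f" by (simp add: square_integrable_def)
  have "(\<integral>\<^sup>+\<omega>. ennreal ((norm (f \<omega>))\<^sup>2) \<partial>P) = ennreal (\<integral>\<omega>. (norm (f \<omega>))\<^sup>2 \<partial>P)"
    by (rule nn_integral_eq_integral[OF int]) simp
  then show "(\<integral>\<omega>. (norm (f \<omega>))\<^sup>2 \<partial>P) \<le> K" using le \<open>K \<ge> 0\<close> by simp
qed

subsection \<open>Independence and conditional moments\<close>

text \<open>
  The library predicate \<open>indep_var\<close> requires both random variables to have the same type.
\<close>

definition (in prob_space) indep_pair ::
  "'b measure \<Rightarrow> ('a \<Rightarrow> 'b) \<Rightarrow> 'c measure \<Rightarrow> ('a \<Rightarrow> 'c) \<Rightarrow> bool" where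
  "indep_pair S X L Y \<longleftrightarrow> X \<in> measurable M S \<and> Y \<in> measurable M L \<and>
     (\<forall>A\<in>sets S. \<forall>B\<in>sets L. prob ((X -` A \<inter> space M) \<inter> (Y -` B \<inter> space M))
        = prob (X -` A \<inter> space M) * prob (Y -` B \<inter> space M))"

text \<open>Every event about \<open>f\<close> is an \<open>X\<close>-preimage, because
  \<open>f\<close> is measurable for the sigma-algebra generated by \<open>X\<close>. The product
  formula for \<open>X\<close> and \<open>X'\<close> therefore transfers directly, and
  \<open>f\<close> never has to be factored through \<open>X\<close>.\<close>

lemma (in prob_space) indep_pair_vimage_algebra:
  assumes ind: "indep_var N X N' X'"
    and f: "f \<in> measurable (vimage_algebra (space M) X N) K"
    and g: "g \<in> measurable N' L"
  shows "indep_pair K f L (\<lambda>\<omega>. g (X' \<omega>))"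
  unfolding indep_pair_def
proof (intro conjI ballI)
  have X: "X \<in> measurable M N" and X': "X' \<in> measurable M N'"
    using ind by (auto simp: indep_var_eq)
  have "sets (vimage_algebra (space M) X N) \<subseteq> sets M"
    by (simp add: X in_vimage_algebra sets_image_in_sets)
  then show "f \<in> measurable M K"
    using f by (auto simp: measurable_def)
  show "(\<lambda>\<omega>. g (X' \<omega>)) \<in> measurable M L"
    using measurable_compose[OF X' g] .
  fix A B assume A: "A \<in> sets K" and B: "B \<in> sets L"
  have "X \<in> space M \<rightarrow> space N" using X by (auto simp: measurable_def)
  then obtain A' where A': "A' \<in> sets N" "f -` A \<inter> space M = X -` A' \<inter> space M"
    using measurable_sets[OF f A] by (auto simp: sets_vimage_algebra2)
  have B': "g -` B \<inter> space N' \<in> sets N'"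
    "(\<lambda>\<omega>. g (X' \<omega>)) -` B \<inter> space M = X' -` (g -` B \<inter> space N') \<inter> space M"
    using measurable_sets[OF g B] measurable_space[OF X'] by auto
  have "(\<lambda>\<omega>. (X \<omega>, X' \<omega>)) -` (A' \<times> (g -` B \<inter> space N')) \<inter> space M
      = (X -` A' \<inter> space M) \<inter> (X' -` (g -` B \<inter> space N') \<inter> space M)"
    by auto
  then show "prob ((f -` A \<inter> space M) \<inter> ((\<lambda>\<omega>. g (X' \<omega>)) -` B \<inter> space M))
      = prob (f -` A \<inter> space M) * prob ((\<lambda>\<omega>. g (X' \<omega>)) -` B \<inter> space M)"
    unfolding A'(2) B'(2) using indep_varD[OF ind A'(1) B'(1)] by simp
qed

text \<open>Independence says that both measures agree on rectangles, and rectangles determine a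
  product of sigma-finite measures.\<close>

lemma (in prob_space) indep_pair_distr:
  assumes "indep_pair S X L Y"
  shows "distr M S X \<Otimes>\<^sub>M distr M L Y = distr M (S \<Otimes>\<^sub>M L) (\<lambda>x. (X x, Y x))"
proof -
  have X[measurable]: "X \<in> measurable M S" and Y[measurable]: "Y \<in> measurable M L"
    and prod: "\<And>A B. A \<in> sets S \<Longrightarrow> B \<in> sets L \<Longrightarrow>
      prob ((X -` A \<inter> space M) \<inter> (Y -` B \<inter> space M)) = prob (X -` A \<inter> space M) * prob (Y -` B \<inter> space M)"
    using assms by (auto simp: indep_pair_def)
  interpret L: prob_space "distr M L Y" by (rule prob_space_distr) measurable
  interpret S: prob_space "distr M S X" by (rule prob_space_distr) measurable
  show ?thesis
  proof (rule pair_measure_eqI)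
    fix A B assume "A \<in> sets (distr M S X)" "B \<in> sets (distr M L Y)"
    then have AB[measurable]: "A \<in> sets S" "B \<in> sets L" by auto
    have "(\<lambda>x. (X x, Y x)) -` (A \<times> B) \<inter> space M = (X -` A \<inter> space M) \<inter> (Y -` B \<inter> space M)"
      by auto
    then show "emeasure (distr M S X) A * emeasure (distr M L Y) B
        = emeasure (distr M (S \<Otimes>\<^sub>M L) (\<lambda>x. (X x, Y x))) (A \<times> B)"
      using prod[OF AB] by (simp add: emeasure_distr emeasure_eq_measure ennreal_mult)
  qed (simp_all add: L.sigma_finite_measure_axioms S.sigma_finite_measure_axioms)
qed

text \<open>Tonelli for the product law: \<open>X\<close> may be frozen at \<open>X \<omega>\<close>
  while \<open>Y\<close> is averaged with a separate variable \<omega>'.\<close>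

lemma (in prob_space) indep_pair_nn_integral:
  assumes ind: "indep_pair S X L Y" and [measurable]: "h \<in> borel_measurable (S \<Otimes>\<^sub>M L)"
  shows "(\<integral>\<^sup>+\<omega>. h (X \<omega>, Y \<omega>) \<partial>M) = (\<integral>\<^sup>+\<omega>. (\<integral>\<^sup>+\<omega>'. h (X \<omega>, Y \<omega>') \<partial>M) \<partial>M)"
proof -
  have [measurable]: "X \<in> measurable M S" "Y \<in> measurable M L"
    and eq: "distr M S X \<Otimes>\<^sub>M distr M L Y = distr M (S \<Otimes>\<^sub>M L) (\<lambda>x. (X x, Y x))"
    using ind indep_pair_distr[OF ind] by (auto simp: indep_pair_def)
  interpret L: prob_space "distr M L Y" by (rule prob_space_distr) measurable
  have "(\<integral>\<^sup>+\<omega>. h (X \<omega>, Y \<omega>) \<partial>M) = (\<integral>\<^sup>+z. h z \<partial>(distr M S X \<Otimes>\<^sub>M distr M L Y))"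
    unfolding eq by (subst nn_integral_distr) auto
  also have "\<dots> = (\<integral>\<^sup>+x. (\<integral>\<^sup>+y. h (x, y) \<partial>distr M L Y) \<partial>distr M S X)"
    by (rule L.nn_integral_fst[symmetric]) simp
  also have "\<dots> = (\<integral>\<^sup>+\<omega>. (\<integral>\<^sup>+y. h (X \<omega>, y) \<partial>distr M L Y) \<partial>M)"
    by (rule nn_integral_distr) auto
  also have "\<dots> = (\<integral>\<^sup>+\<omega>. (\<integral>\<^sup>+\<omega>'. h (X \<omega>, Y \<omega>') \<partial>M) \<partial>M)"
    using measurable_space[of X M S]
    by (intro nn_integral_cong nn_integral_distr) auto
  finally show ?thesis .
qed

text \<open>Fubini for the product law: the inner integral vanishes for each frozen value of
  \<open>X\<close>. This stands in for a vanishing conditional expectation given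
  \<open>X\<close>.\<close>

lemma (in prob_space) indep_pair_integral_eq_zero:
  fixes h :: "_ \<Rightarrow> real"
  assumes ind: "indep_pair S X L Y" and [measurable]: "h \<in> borel_measurable (S \<Otimes>\<^sub>M L)"
    and int: "integrable M (\<lambda>\<omega>. h (X \<omega>, Y \<omega>))"
    and zero: "\<And>x. x \<in> space S \<Longrightarrow> (\<integral>\<omega>. h (x, Y \<omega>) \<partial>M) = 0"
  shows "(\<integral>\<omega>. h (X \<omega>, Y \<omega>) \<partial>M) = 0"
proof -
  have [measurable]: "X \<in> measurable M S" "Y \<in> measurable M L"
    and eq: "distr M S X \<Otimes>\<^sub>M distr M L Y = distr M (S \<Otimes>\<^sub>M L) (\<lambda>x. (X x, Y x))"
    using ind indep_pair_distr[OF ind] by (auto simp: indep_pair_def)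
  interpret L: prob_space "distr M L Y" by (rule prob_space_distr) measurable
  interpret S: prob_space "distr M S X" by (rule prob_space_distr) measurable
  interpret pair_sigma_finite "distr M S X" "distr M L Y" ..
  \<comment> \<open>Integrability under the joint law is what licenses Fubini; it is only known
    along \<open>(X, Y)\<close> and is transported here.\<close>
  have "integrable (distr M (S \<Otimes>\<^sub>M L) (\<lambda>x. (X x, Y x))) h"
    using int by (subst integrable_distr_eq) auto
  then have "(\<integral>x. (\<integral>y. h (x, y) \<partial>distr M L Y) \<partial>distr M S X)
      = (\<integral>z. h z \<partial>distr M (S \<Otimes>\<^sub>M L) (\<lambda>x. (X x, Y x)))"
    unfolding eq[symmetric] by (rule integral_fst')
  also have "\<dots> = (\<integral>\<omega>. h (X \<omega>, Y \<omega>) \<partial>M)"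
    by (subst integral_distr) auto
  also have "(\<integral>x. (\<integral>y. h (x, y) \<partial>distr M L Y) \<partial>distr M S X) = (\<integral>x. 0 \<partial>distr M S X)"
  proof (rule Bochner_Integration.integral_cong)
    fix x assume "x \<in> space (distr M S X)"
    then have x: "x \<in> space S" by simp
    then have "(\<integral>y. h (x, y) \<partial>distr M L Y) = (\<integral>\<omega>. h (x, Y \<omega>) \<partial>M)"
      by (intro integral_distr) auto
    then show "(\<integral>y. h (x, y) \<partial>distr M L Y) = 0" using zero[OF x] by simp
  qed simp
  finally show ?thesis by simp
qed

text \<open>Conditioning preserves the integral (test function 1), and a constant integrates to
  itself under a probability measure.\<close>

lemma (in prob_space) nn_integral_le_of_nn_cond_exp_le:
  assumes "subalgebra M F" and [measurable]: "g \<in> borel_measurable M"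
    and le: "AE \<omega> in M. nn_cond_exp M F g \<omega> \<le> K"
  shows "(\<integral>\<^sup>+\<omega>. g \<omega> \<partial>M) \<le> K"
proof -
  interpret F: finite_measure_subalgebra M F by standard fact
  have "(\<integral>\<^sup>+\<omega>. g \<omega> \<partial>M) = (\<integral>\<^sup>+\<omega>. nn_cond_exp M F g \<omega> \<partial>M)"
    using F.nn_cond_exp_intg[of "\<lambda>_. 1" g] by simp
  also have "\<dots> \<le> (\<integral>\<^sup>+\<omega>. K \<partial>M)" using le by (rule nn_integral_mono_AE)
  finally show ?thesis by (simp add: emeasure_space_1)
qed

text \<open>Conditional expectations are characterized by their integrals over a sub-sigma-algebra
  of \<open>P\<close>; this provides it for conditioning on observations.\<close>

lemma subalgebra_history:
  assumes "\<And>s. s \<in> {1..t} \<Longrightarrow> X s \<in> borel_measurable P"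
  shows "subalgebra P (history P X t)"
proof -
  let ?A = "\<Union>s\<in>{1..t}. {X s -` A \<inter> space P | A. A \<in> sets borel}"
  have "?A \<subseteq> sets P" using assms by (auto simp: measurable_sets)
  moreover have "?A \<subseteq> Pow (space P)" by auto
  ultimately show ?thesis
    unfolding subalgebra_def history_def by (auto simp: sets.sigma_sets_subset)
qed

subsection \<open>Regret against an adaptive comparator\<close>

text \<open>The update \<open>v\<close> is the minimizer of the linear term with slope
  \<open>g\<close>, plus the anchor penalty \<open>\<rho> / 2 * (norm (v - a))\<^sup>2\<close>, plus
  the proximity term \<open>(norm (v - u))\<^sup>2 / (2 * \<eta>)\<close>. The bound comes from its
  optimality condition, with \<open>g \<bullet> (u - w)\<close> split at \<open>v\<close>.\<close>

lemma prox_step_bound: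
  fixes u v g a w :: "'a::real_inner"
  assumes "\<eta> > 0" "\<rho> \<ge> 0"
    and v: "v = (u - \<eta> *\<^sub>R g + (\<rho> * \<eta>) *\<^sub>R a) /\<^sub>R (1 + \<rho> * \<eta>)"
  shows "g \<bullet> (u - w) + \<rho> / 2 * (norm (v - a))\<^sup>2
    \<le> \<rho> / 2 * (norm (w - a))\<^sup>2 + ((norm (w - u))\<^sup>2 - (norm (w - v))\<^sup>2) / (2 * \<eta>) + \<eta> / 2 * (norm g)\<^sup>2"
proof -
  have "1 + \<rho> * \<eta> \<noteq> 0" using assms(1,2) by (smt (verit) mult_nonneg_nonneg)
  then have "(1 + \<rho> * \<eta>) *\<^sub>R v = u - \<eta> *\<^sub>R g + (\<rho> * \<eta>) *\<^sub>R a" by (simp add: v)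
  \<comment> \<open>First-order optimality of the proximal step, solved for the gradient.\<close>
  then have g: "\<eta> *\<^sub>R g = (u - v) + (\<rho> * \<eta>) *\<^sub>R (a - v)"
    by (simp add: algebra_simps)
  \<comment> \<open>Young's inequality for the part from \<open>u\<close> to \<open>v\<close>; its
    term \<open>(norm (u - v))\<^sup>2\<close> cancels against the identity that follows.\<close>
  have "0 \<le> (norm (\<eta> *\<^sub>R g - (u - v)))\<^sup>2" by simp
  then have "2 * (\<eta> *\<^sub>R g \<bullet> (u - v)) \<le> \<eta>\<^sup>2 * (norm g)\<^sup>2 + (norm (u - v))\<^sup>2"
    unfolding power2_norm_eq_inner inner_diff_left inner_diff_right inner_scaleR_left inner_scaleR_right
    by (simp add: inner_commute power2_eq_square algebra_simps)
  \<comment> \<open>Two three-point identities, one based at \<open>u\<close> and one at the anchor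
    \<open>a\<close>.\<close>
  moreover have "2 * (\<eta> *\<^sub>R g \<bullet> (v - w))
      = ((norm (w - u))\<^sup>2 - (norm (u - v))\<^sup>2 - (norm (w - v))\<^sup>2)
        + \<rho> * \<eta> * ((norm (w - a))\<^sup>2 - (norm (v - a))\<^sup>2 - (norm (w - v))\<^sup>2)"
    unfolding g power2_norm_eq_inner
    by (simp add: inner_add_left inner_diff_left inner_diff_right inner_commute algebra_simps)
  ultimately have "2 * \<eta> * (g \<bullet> (u - w)) \<le> \<eta>\<^sup>2 * (norm g)\<^sup>2 + (norm (w - u))\<^sup>2 - (norm (w - v))\<^sup>2
        + \<rho> * \<eta> * ((norm (w - a))\<^sup>2 - (norm (v - a))\<^sup>2 - (norm (w - v))\<^sup>2)"
    by (simp add: inner_diff_right algebra_simps)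
  \<comment> \<open>The nonpositive term in \<open>(norm (w - v))\<^sup>2\<close> with weight
    \<open>\<rho> * \<eta>\<close> is discarded.\<close>
  also have "\<dots> \<le> \<eta>\<^sup>2 * (norm g)\<^sup>2 + (norm (w - u))\<^sup>2 - (norm (w - v))\<^sup>2
        + \<rho> * \<eta> * ((norm (w - a))\<^sup>2 - (norm (v - a))\<^sup>2)"
    using assms by (intro add_left_mono mult_left_mono) auto
  finally have "2 * \<eta> * (g \<bullet> (u - w)) \<le> \<eta>\<^sup>2 * (norm g)\<^sup>2 + (norm (w - u))\<^sup>2 - (norm (w - v))\<^sup>2
        + \<rho> * \<eta> * ((norm (w - a))\<^sup>2 - (norm (v - a))\<^sup>2)" .
  then have "g \<bullet> (u - w) \<le> (\<eta>\<^sup>2 * (norm g)\<^sup>2 + (norm (w - u))\<^sup>2 - (norm (w - v))\<^sup>2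
        + \<rho> * \<eta> * ((norm (w - a))\<^sup>2 - (norm (v - a))\<^sup>2)) / (2 * \<eta>)"
    using assms(1) by (subst pos_le_divide_eq) (simp_all add: mult_ac)
  also have "\<dots> = \<eta> / 2 * (norm g)\<^sup>2 + ((norm (w - u))\<^sup>2 - (norm (w - v))\<^sup>2) / (2 * \<eta>)
      + \<rho> / 2 * ((norm (w - a))\<^sup>2 - (norm (v - a))\<^sup>2)"
    using assms(1) by (simp add: field_simps power2_eq_square)
  finally show ?thesis by (simp add: algebra_simps)
qed

text \<open>The one-step bounds telescope in the distance to \<open>w\<close>. They penalize the new
  point \<open>u (Suc t)\<close>, whereas the sum here runs over \<open>u t\<close>; the shift costs
  nothing because \<open>u 1\<close> is the anchor itself.\<close>

lemma prox_regret_bound: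
  fixes u g :: "nat \<Rightarrow> 'a::real_inner"
  assumes "\<eta> > 0" "\<rho> \<ge> 0"
    and init: "u 1 = a"
    and step: "\<And>t. t \<in> {1..T} \<Longrightarrow>
      u (Suc t) = (u t - \<eta> *\<^sub>R g t + (\<rho> * \<eta>) *\<^sub>R a) /\<^sub>R (1 + \<rho> * \<eta>)"
  shows "(\<Sum>t=1..T. g t \<bullet> (u t - w)) + \<rho> / 2 * (\<Sum>t=1..T. (norm (u t - a))\<^sup>2)
    \<le> (\<rho> * real T / 2 + 1 / (2 * \<eta>)) * (norm (w - a))\<^sup>2 + \<eta> / 2 * (\<Sum>t=1..T. (norm (g t))\<^sup>2)"
proof -
  \<comment> \<open>The induction keeps the two nonnegative end terms at \<open>u (Suc T)\<close>:
    the anchor term moves into the sum in the next round, and the distance term telescopes.\<close>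
  have "(\<Sum>t=1..T. g t \<bullet> (u t - w)) + \<rho> / 2 * (\<Sum>t=1..T. (norm (u t - a))\<^sup>2)
      + \<rho> / 2 * (norm (u (Suc T) - a))\<^sup>2 + (norm (w - u (Suc T)))\<^sup>2 / (2 * \<eta>)
    \<le> (\<rho> * real T / 2 + 1 / (2 * \<eta>)) * (norm (w - a))\<^sup>2 + \<eta> / 2 * (\<Sum>t=1..T. (norm (g t))\<^sup>2)"
    using step
  proof (induction T)
    case 0
    then show ?case using init by simp
  next
    case (Suc T)
    have "g (Suc T) \<bullet> (u (Suc T) - w) + \<rho> / 2 * (norm (u (Suc (Suc T)) - a))\<^sup>2
      \<le> \<rho> / 2 * (norm (w - a))\<^sup>2
        + ((norm (w - u (Suc T)))\<^sup>2 - (norm (w - u (Suc (Suc T))))\<^sup>2) / (2 * \<eta>)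
        + \<eta> / 2 * (norm (g (Suc T)))\<^sup>2"
      using Suc.prems[of "Suc T"] by (intro prox_step_bound assms(1,2)) auto
    moreover have "(\<Sum>t=1..T. g t \<bullet> (u t - w)) + \<rho> / 2 * (\<Sum>t=1..T. (norm (u t - a))\<^sup>2)
      + \<rho> / 2 * (norm (u (Suc T) - a))\<^sup>2 + (norm (w - u (Suc T)))\<^sup>2 / (2 * \<eta>)
    \<le> (\<rho> * real T / 2 + 1 / (2 * \<eta>)) * (norm (w - a))\<^sup>2 + \<eta> / 2 * (\<Sum>t=1..T. (norm (g t))\<^sup>2)"
      using Suc by auto
    ultimately show ?case
      by (simp add: distrib_left distrib_right diff_divide_distrib add_divide_distrib)
  qed
  moreover have "0 \<le> \<rho> / 2 * (norm (u (Suc T) - a))\<^sup>2" "0 \<le> (norm (w - u (Suc T)))\<^sup>2 / (2 * \<eta>)"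
    using assms(1,2) by simp_all
  ultimately show ?thesis by linarith
qed

text \<open>Pythagoras in \<open>L^2(P)\<close>: on adding the last vector, the cross term is a sum
  of vanishing correlations.\<close>

lemma (in prob_space) expectation_norm_sum_orthogonal:
  fixes d :: "nat \<Rightarrow> 'a \<Rightarrow> 'b::euclidean_space"
  assumes sq: "\<And>t. t \<in> {1..T} \<Longrightarrow> square_integrable M (d t)"
    and orth: "\<And>s t. 1 \<le> s \<Longrightarrow> s < t \<Longrightarrow> t \<le> T \<Longrightarrow> expectation (\<lambda>\<omega>. d s \<omega> \<bullet> d t \<omega>) = 0"
  shows "expectation (\<lambda>\<omega>. (norm (\<Sum>t=1..T. d t \<omega>))\<^sup>2) = (\<Sum>t=1..T. expectation (\<lambda>\<omega>. (norm (d t \<omega>))\<^sup>2))"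
  using assms
proof (induction T)
  case 0
  then show ?case by simp
next
  case (Suc T)
  let ?S = "\<lambda>\<omega>. \<Sum>t=1..T. d t \<omega>"
  have dT: "square_integrable M (d (Suc T))" and S: "square_integrable M ?S"
    using Suc.prems(1) by (auto intro!: square_integrable_sum)
  have cross: "expectation (\<lambda>\<omega>. ?S \<omega> \<bullet> d (Suc T) \<omega>) = 0"
    using Suc.prems
    by (simp add: inner_sum_left Bochner_Integration.integral_sum square_integrable_inner)
  have "(norm (\<Sum>t=1..Suc T. d t \<omega>))\<^sup>2
      = (norm (?S \<omega>))\<^sup>2 + 2 * (?S \<omega> \<bullet> d (Suc T) \<omega>) + (norm (d (Suc T) \<omega>))\<^sup>2" for \<omega>
    by (simp add: power2_norm_eq_inner inner_add inner_commute)
  then have "expectation (\<lambda>\<omega>. (norm (\<Sum>t=1..Suc T. d t \<omega>))\<^sup>2)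
      = expectation (\<lambda>\<omega>. (norm (?S \<omega>))\<^sup>2) + expectation (\<lambda>\<omega>. (norm (d (Suc T) \<omega>))\<^sup>2)"
    using dT S cross by (simp add: square_integrable_inner square_integrable_integrable)
  with Suc show ?case by simp
qed

text \<open>Here \<open>h\<close> is the stochastic and \<open>g\<close> the exact gradient.
  \<open>orth_u\<close> removes the noise paired with the iterates, \<open>orth_h\<close> makes the
  accumulated noise a sum of orthogonal terms, and \<open>orth_g\<close> bounds each term by the
  second moment of \<open>h\<close>. The pathwise regret and Young's inequality each contribute
  \<eta>/2 and 1/(2\<eta>), hence the constants \<eta> and 1/\<eta>.\<close>

lemma (in prob_space) adaptive_regret_bound:
  fixes u g h :: "nat \<Rightarrow> 'a \<Rightarrow> 'b::euclidean_space"
  assumes "\<eta> > 0" "\<rho> \<ge> 0"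
    and init: "\<And>\<omega>. u 1 \<omega> = a"
    and step: "\<And>t \<omega>. t \<in> {1..T} \<Longrightarrow>
      u (Suc t) \<omega> = (u t \<omega> - \<eta> *\<^sub>R h t \<omega> + (\<rho> * \<eta>) *\<^sub>R a) /\<^sub>R (1 + \<rho> * \<eta>)"
    and sq: "\<And>t. t \<in> {1..T} \<Longrightarrow> square_integrable M (u t)"
      "\<And>t. t \<in> {1..T} \<Longrightarrow> square_integrable M (g t)"
      "\<And>t. t \<in> {1..T} \<Longrightarrow> square_integrable M (h t)"
    and w: "square_integrable M w"
    and orth_u: "\<And>t. t \<in> {1..T} \<Longrightarrow> expectation (\<lambda>\<omega>. (h t \<omega> - g t \<omega>) \<bullet> (u t \<omega> - a)) = 0"
    and orth_g: "\<And>t. t \<in> {1..T} \<Longrightarrow> expectation (\<lambda>\<omega>. (h t \<omega> - g t \<omega>) \<bullet> g t \<omega>) = 0"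
    and orth_h: "\<And>s t. 1 \<le> s \<Longrightarrow> s < t \<Longrightarrow> t \<le> T \<Longrightarrow>
      expectation (\<lambda>\<omega>. (h s \<omega> - g s \<omega>) \<bullet> (h t \<omega> - g t \<omega>)) = 0"
  shows "(\<Sum>t=1..T. expectation (\<lambda>\<omega>. g t \<omega> \<bullet> (u t \<omega> - w \<omega>)))
      + \<rho> / 2 * (\<Sum>t=1..T. expectation (\<lambda>\<omega>. (norm (u t \<omega> - a))\<^sup>2))
    \<le> (\<rho> * real T / 2 + 1 / \<eta>) * expectation (\<lambda>\<omega>. (norm (w \<omega> - a))\<^sup>2)
      + \<eta> * (\<Sum>t=1..T. expectation (\<lambda>\<omega>. (norm (h t \<omega>))\<^sup>2))"
proof -
  let ?S = "\<lambda>\<omega>. \<Sum>t=1..T. h t \<omega> - g t \<omega>"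
  have d: "square_integrable M (\<lambda>\<omega>. h t \<omega> - g t \<omega>)" if "t \<in> {1..T}" for t
    using sq that by (intro square_integrable_diff)
  have ua: "square_integrable M (\<lambda>\<omega>. u t \<omega> - a)" if "t \<in> {1..T}" for t
    using sq that by (intro square_integrable_diff square_integrable_const)
  have uw: "square_integrable M (\<lambda>\<omega>. u t \<omega> - w \<omega>)" if "t \<in> {1..T}" for t
    using sq w that by (intro square_integrable_diff)
  have wa: "square_integrable M (\<lambda>\<omega>. w \<omega> - a)"
    using w by (intro square_integrable_diff square_integrable_const)
  have S: "square_integrable M ?S"
    using d by (intro square_integrable_sum)
  have pathwise: "(\<Sum>t=1..T. g t \<omega> \<bullet> (u t \<omega> - w \<omega>)) + \<rho> / 2 * (\<Sum>t=1..T. (norm (u t \<omega> - a))\<^sup>2)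
    \<le> (\<rho> * real T / 2 + 1 / \<eta>) * (norm (w \<omega> - a))\<^sup>2 + \<eta> / 2 * (\<Sum>t=1..T. (norm (h t \<omega>))\<^sup>2)
      + \<eta> / 2 * (norm (?S \<omega>))\<^sup>2 - (\<Sum>t=1..T. (h t \<omega> - g t \<omega>) \<bullet> (u t \<omega> - a))" for \<omega>
  proof -
    \<comment> \<open>Young's inequality, weighted by \<eta>, for the only term that couples noise
      and comparator.\<close>
    have "0 \<le> (norm (\<eta> *\<^sub>R ?S \<omega> - (w \<omega> - a)))\<^sup>2" by simp
    also have "\<dots> = \<eta>\<^sup>2 * (norm (?S \<omega>))\<^sup>2 - 2 * \<eta> * (?S \<omega> \<bullet> (w \<omega> - a)) + (norm (w \<omega> - a))\<^sup>2"
      by (simp only: power2_norm_eq_inner inner_diff_left[of "_ *\<^sub>R _"] inner_diff_right[of _ "_ *\<^sub>R _"]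
          inner_scaleR_left inner_scaleR_right)
        (simp add: inner_commute power2_eq_square algebra_simps)
    finally have "?S \<omega> \<bullet> (w \<omega> - a) \<le> (\<eta>\<^sup>2 * (norm (?S \<omega>))\<^sup>2 + (norm (w \<omega> - a))\<^sup>2) / (2 * \<eta>)"
      using assms(1) by (subst pos_le_divide_eq) (simp_all add: mult_ac)
    also have "\<dots> = \<eta> / 2 * (norm (?S \<omega>))\<^sup>2 + 1 / (2 * \<eta>) * (norm (w \<omega> - a))\<^sup>2"
      using assms(1) by (simp add: field_simps power2_eq_square)
    finally have ag: "?S \<omega> \<bullet> (w \<omega> - a) \<le> \<eta> / 2 * (norm (?S \<omega>))\<^sup>2 + 1 / (2 * \<eta>) * (norm (w \<omega> - a))\<^sup>2" .
    \<comment> \<open>The noise paired with \<open>u t - w\<close> is split at the anchor: the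
      \<open>u t - a\<close> part has mean zero, while the \<open>w - a\<close> part factors through
      the accumulated noise.\<close>
    have "(\<Sum>t=1..T. g t \<omega> \<bullet> (u t \<omega> - w \<omega>)) = (\<Sum>t=1..T. h t \<omega> \<bullet> (u t \<omega> - w \<omega>))
        - (\<Sum>t=1..T. (h t \<omega> - g t \<omega>) \<bullet> (u t \<omega> - a)) + ?S \<omega> \<bullet> (w \<omega> - a)"
      unfolding inner_sum_left sum_subtractf[symmetric] sum.distrib[symmetric]
      by (intro sum.cong) (auto simp: inner_diff_left inner_diff_right)
    moreover have "(\<Sum>t=1..T. h t \<omega> \<bullet> (u t \<omega> - w \<omega>)) + \<rho> / 2 * (\<Sum>t=1..T. (norm (u t \<omega> - a))\<^sup>2)
      \<le> (\<rho> * real T / 2 + 1 / (2 * \<eta>)) * (norm (w \<omega> - a))\<^sup>2 + \<eta> / 2 * (\<Sum>t=1..T. (norm (h t \<omega>))\<^sup>2)"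
      using assms by (intro prox_regret_bound) auto
    ultimately show ?thesis using ag by (simp add: field_simps)
  qed
  \<comment> \<open>The noise is orthogonal to the exact gradient, so its second moment is that of
    \<open>h\<close> less that of \<open>g\<close>.\<close>
  have dh: "expectation (\<lambda>\<omega>. (norm (h t \<omega> - g t \<omega>))\<^sup>2) \<le> expectation (\<lambda>\<omega>. (norm (h t \<omega>))\<^sup>2)"
    if t: "t \<in> {1..T}" for t
  proof -
    have "(norm (h t \<omega>))\<^sup>2 = (norm (h t \<omega> - g t \<omega>))\<^sup>2 + 2 * ((h t \<omega> - g t \<omega>) \<bullet> g t \<omega>) + (norm (g t \<omega>))\<^sup>2" for \<omega>
      by (simp add: power2_norm_eq_inner inner_diff inner_commute)
    then have "expectation (\<lambda>\<omega>. (norm (h t \<omega>))\<^sup>2)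
        = expectation (\<lambda>\<omega>. (norm (h t \<omega> - g t \<omega>))\<^sup>2) + expectation (\<lambda>\<omega>. (norm (g t \<omega>))\<^sup>2)"
      using d[OF t] sq(2)[OF t] orth_g[OF t]
      by (simp add: square_integrable_inner square_integrable_integrable)
    then show ?thesis by simp
  qed
  have "expectation (\<lambda>\<omega>. (norm (?S \<omega>))\<^sup>2) = (\<Sum>t=1..T. expectation (\<lambda>\<omega>. (norm (h t \<omega> - g t \<omega>))\<^sup>2))"
    using d orth_h by (intro expectation_norm_sum_orthogonal) auto
  also have "\<dots> \<le> (\<Sum>t=1..T. expectation (\<lambda>\<omega>. (norm (h t \<omega>))\<^sup>2))"
    using dh by (intro sum_mono)
  finally have ES: "\<eta> / 2 * expectation (\<lambda>\<omega>. (norm (?S \<omega>))\<^sup>2)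
      \<le> \<eta> / 2 * (\<Sum>t=1..T. expectation (\<lambda>\<omega>. (norm (h t \<omega>))\<^sup>2))"
    using assms(1) by (intro mult_left_mono) auto
  have int: "integrable M (\<lambda>\<omega>. g t \<omega> \<bullet> (u t \<omega> - w \<omega>))" "integrable M (\<lambda>\<omega>. (norm (u t \<omega> - a))\<^sup>2)"
    "integrable M (\<lambda>\<omega>. (norm (h t \<omega>))\<^sup>2)" "integrable M (\<lambda>\<omega>. (h t \<omega> - g t \<omega>) \<bullet> (u t \<omega> - a))"
    if "t \<in> {1..T}" for t
    using that d ua uw sq by (auto intro!: square_integrable_inner square_integrable_integrable)
  note int' = square_integrable_integrable[OF wa] square_integrable_integrable[OF S]
  have "has_bochner_integral M
      (\<lambda>\<omega>. (\<Sum>t=1..T. g t \<omega> \<bullet> (u t \<omega> - w \<omega>)) + \<rho> / 2 * (\<Sum>t=1..T. (norm (u t \<omega> - a))\<^sup>2))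
      ((\<Sum>t=1..T. expectation (\<lambda>\<omega>. g t \<omega> \<bullet> (u t \<omega> - w \<omega>)))
        + \<rho> / 2 * (\<Sum>t=1..T. expectation (\<lambda>\<omega>. (norm (u t \<omega> - a))\<^sup>2)))" (is "has_bochner_integral M ?l ?L")
    by (intro has_bochner_integral_add has_bochner_integral_mult_right has_bochner_integral_sum
        has_bochner_integral_integrable int)
  then have l: "integrable M ?l" "expectation ?l = ?L" by (simp_all add: has_bochner_integral_iff)
  have "has_bochner_integral M
      (\<lambda>\<omega>. (\<rho> * real T / 2 + 1 / \<eta>) * (norm (w \<omega> - a))\<^sup>2 + \<eta> / 2 * (\<Sum>t=1..T. (norm (h t \<omega>))\<^sup>2)
        + \<eta> / 2 * (norm (?S \<omega>))\<^sup>2 - (\<Sum>t=1..T. (h t \<omega> - g t \<omega>) \<bullet> (u t \<omega> - a)))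
      ((\<rho> * real T / 2 + 1 / \<eta>) * expectation (\<lambda>\<omega>. (norm (w \<omega> - a))\<^sup>2)
        + \<eta> / 2 * (\<Sum>t=1..T. expectation (\<lambda>\<omega>. (norm (h t \<omega>))\<^sup>2)) + \<eta> / 2 * expectation (\<lambda>\<omega>. (norm (?S \<omega>))\<^sup>2)
        - (\<Sum>t=1..T. expectation (\<lambda>\<omega>. (h t \<omega> - g t \<omega>) \<bullet> (u t \<omega> - a))))" (is "has_bochner_integral M ?r ?R")
    by (intro has_bochner_integral_add has_bochner_integral_diff has_bochner_integral_mult_right
        has_bochner_integral_sum has_bochner_integral_integrable int int')
  then have r: "integrable M ?r" "expectation ?r = ?R" by (simp_all add: has_bochner_integral_iff)
  have "?L \<le> ?R"
    unfolding l(2)[symmetric] r(2)[symmetric] using l(1) r(1) pathwise by (rule integral_mono)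
  moreover have "(\<Sum>t=1..T. expectation (\<lambda>\<omega>. (h t \<omega> - g t \<omega>) \<bullet> (u t \<omega> - a))) = 0"
    using orth_u by simp
  ultimately show ?thesis using ES by (simp only: distrib_left)
qed

subsection \<open>COGDA under the noise model\<close>

text \<open>Linearity in the matrix at a frozen vector carries the zero mean of \<xi>M over to the
  gradient noise; the next fact does the same for the transpose.\<close>

lemma bounded_linear_matrix_vector_mult_left:
  "bounded_linear (\<lambda>A::real^'n^'m. A *v y)"
  by (simp add: linear_conv_bounded_linear[symmetric] linear_iff matrix_vector_mult_add_rdistrib
      scaleR_matrix_vector_assoc)

lemma bounded_linear_transpose_vector_mult_left:
  "bounded_linear (\<lambda>A::real^'n^'m. transpose A *v x)"
  by (simp add: linear_conv_bounded_linear[symmetric] linear_iff vec_eq_iff vector_matrix_mult_def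
      sum.distrib sum_distrib_left algebra_simps)

section \<open>Continuity and measurability of matrix products\<close>

lemma continuous_on_matrix_vector_mult_joint [continuous_intros]:
  fixes f :: "'a::topological_space \<Rightarrow> real^'n^'m"
  assumes "continuous_on S f" "continuous_on S g"
  shows "continuous_on S (\<lambda>x. f x *v g x)"
  unfolding matrix_vector_mult_def by (intro continuous_intros assms)

lemma continuous_on_transpose [continuous_intros]:
  fixes f :: "'a::topological_space \<Rightarrow> real^'n^'m"
  assumes "continuous_on S f"
  shows "continuous_on S (\<lambda>x. transpose (f x))"
  unfolding transpose_def by (intro continuous_intros assms)

lemma borel_measurable_matrix_vector_mult [measurable (raw)]:
  fixes f :: "'a \<Rightarrow> real^'n^'m"
  assumes "f \<in> borel_measurable N" "g \<in> borel_measurable N"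
  shows "(\<lambda>x. f x *v g x) \<in> borel_measurable N"
  by (rule borel_measurable_continuous_Pair[OF assms]) (intro continuous_intros)

lemma borel_measurable_transpose [measurable (raw)]:
  fixes f :: "'a \<Rightarrow> real^'n^'m"
  assumes "f \<in> borel_measurable N"
  shows "(\<lambda>x. transpose (f x)) \<in> borel_measurable N"
proof -
  have "continuous_on UNIV (transpose :: real^'n^'m \<Rightarrow> _)"
    using continuous_on_transpose[OF continuous_on_id] by (simp add: id_def)
  then show ?thesis
    using measurable_compose[OF assms borel_measurable_continuous_onI] by blast
qed

text \<open>\<open>saddle_f\<close> is affine in each argument, so the gap at the averages is the
  average of the gaps. By bilinearity each gap equals the sum of the two linearized regrets exactly,
  since the terms with \<open>M\<close> evaluated at both iterates cancel. The minus sign makes the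
  second player a minimizer too.\<close>

lemma saddle_gap_average:
  fixes x :: "nat \<Rightarrow> real^'m" and y :: "nat \<Rightarrow> real^'n"
  assumes "T \<ge> 1"
  shows "saddle_f M b c ((\<Sum>t=1..T. x t) /\<^sub>R real T) ys - saddle_f M b c xs ((\<Sum>t=1..T. y t) /\<^sub>R real T)
    = ((\<Sum>t=1..T. (M *v y t + b) \<bullet> (x t - xs)) + (\<Sum>t=1..T. - (transpose M *v x t - c) \<bullet> (y t - ys))) / real T"
proof -
  have T: "real T > 0" using assms by simp
  have 1: "saddle_f M b c ((\<Sum>t=1..T. x t) /\<^sub>R real T) ys = (\<Sum>t=1..T. saddle_f M b c (x t) ys) / real T"
    using T by (simp add: saddle_f_def inner_sum_left inner_sum_right sum.distrib sum_subtractf field_simps)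
  have "M *v (\<Sum>t=1..T. y t) = (\<Sum>t=1..T. M *v y t)"
    by (rule linear_sum) simp
  then have 2: "saddle_f M b c xs ((\<Sum>t=1..T. y t) /\<^sub>R real T) = (\<Sum>t=1..T. saddle_f M b c xs (y t)) / real T"
    using T by (simp add: saddle_f_def matrix_vector_mult_scaleR inner_sum_right sum.distrib sum_subtractf field_simps)
  have "saddle_f M b c u ys - saddle_f M b c xs v
      = (M *v v + b) \<bullet> (u - xs) + - (transpose M *v u - c) \<bullet> (v - ys)" for u v
  proof -
    have "(transpose M *v u) \<bullet> w = u \<bullet> (M *v w)" for w
      by (simp add: dot_lmul_matrix)
    then show ?thesis
      by (simp add: saddle_f_def inner_diff_left inner_diff_right inner_add_left inner_add_right inner_commute
          matrix_vector_right_distrib matrix_vector_mult_diff_distrib del: transpose_matrix_vector)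
  qed
  then show ?thesis
    unfolding 1 2 diff_divide_distrib[symmetric] sum_subtractf[symmetric] sum.distrib[symmetric] by simp
qed

text \<open>Both players are brought into the same descent form: the ascent step in \<open>y\<close>
  becomes a descent step along the negated gradient, so one regret bound serves both. The recursion
  proper starts at round 1; indices 0 and 1 both hold the starting point.\<close>

lemma cogda_Suc:
  assumes "t \<ge> 1"
  shows "fst (cogda \<eta>x \<eta>y \<rho>x \<rho>y x1 y1 A p q (Suc t)) =
      (fst (cogda \<eta>x \<eta>y \<rho>x \<rho>y x1 y1 A p q t)
        - \<eta>x *\<^sub>R (A t *v snd (cogda \<eta>x \<eta>y \<rho>x \<rho>y x1 y1 A p q t) + p t) + (\<rho>x * \<eta>x) *\<^sub>R x1)
      /\<^sub>R (1 + \<rho>x * \<eta>x)"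
    and "snd (cogda \<eta>x \<eta>y \<rho>x \<rho>y x1 y1 A p q (Suc t)) =
      (snd (cogda \<eta>x \<eta>y \<rho>x \<rho>y x1 y1 A p q t)
        - \<eta>y *\<^sub>R (- (transpose (A t) *v fst (cogda \<eta>x \<eta>y \<rho>x \<rho>y x1 y1 A p q t) - q t)) + (\<rho>y * \<eta>y) *\<^sub>R y1)
      /\<^sub>R (1 + \<rho>y * \<eta>y)"
proof -
  obtain k where t: "t = Suc k" using assms by (cases t) auto
  show "fst (cogda \<eta>x \<eta>y \<rho>x \<rho>y x1 y1 A p q (Suc t)) =
      (fst (cogda \<eta>x \<eta>y \<rho>x \<rho>y x1 y1 A p q t)
        - \<eta>x *\<^sub>R (A t *v snd (cogda \<eta>x \<eta>y \<rho>x \<rho>y x1 y1 A p q t) + p t) + (\<rho>x * \<eta>x) *\<^sub>R x1)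
      /\<^sub>R (1 + \<rho>x * \<eta>x)"
    unfolding t by (simp only: cogda.simps Let_def split_beta fst_conv)
  show "snd (cogda \<eta>x \<eta>y \<rho>x \<rho>y x1 y1 A p q (Suc t)) =
      (snd (cogda \<eta>x \<eta>y \<rho>x \<rho>y x1 y1 A p q t)
        - \<eta>y *\<^sub>R (- (transpose (A t) *v fst (cogda \<eta>x \<eta>y \<rho>x \<rho>y x1 y1 A p q t) - q t)) + (\<rho>y * \<eta>y) *\<^sub>R y1)
      /\<^sub>R (1 + \<rho>y * \<eta>y)"
    unfolding t
    by (simp only: cogda.simps Let_def split_beta snd_conv scaleR_minus_right diff_minus_eq_add)
qed

section \<open>Noise, observations and the sigma-algebra of earlier rounds\<close>

context cogda_noise
begin

text \<open>Generated by the noise of the rounds strictly before \<open>t\<close>, in the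
  restricted-product form in which independence of disjoint blocks is stated. Since observations are
  shifts of the noise by constants, they are measurable for it too.\<close>

definition past :: "nat \<Rightarrow> 'w measure" where
  "past t = vimage_algebra (space P) (\<lambda>\<omega>. \<lambda>s\<in>{1..<t}. (\<xi>M s \<omega>, \<xi>b s \<omega>, \<xi>c s \<omega>))
     (PiM {1..<t} (\<lambda>_. borel))"

lemma noise_measurable [measurable]:
  assumes "t \<in> {1..T}"
  shows "\<xi>M t \<in> borel_measurable P" "\<xi>b t \<in> borel_measurable P" "\<xi>c t \<in> borel_measurable P"
  using noise_mean_M[OF assms] noise_mean_b[OF assms] noise_mean_c[OF assms]
  by (auto simp: has_bochner_integral_iff)

lemma obs_measurable [measurable]:
  assumes [measurable]: "t \<in> {1..T}"
  shows "Mh t \<in> borel_measurable P" "bh t \<in> borel_measurable P" "ch t \<in> borel_measurable P"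
  using obs_M[OF assms] obs_b[OF assms] obs_c[OF assms]
  by (simp_all add: noise_measurable[OF assms] cong: measurable_cong)

lemma indep_pair_past:
  fixes f :: "'w \<Rightarrow> 'x::topological_space"
  assumes t: "t \<in> {1..T}" and f: "f \<in> borel_measurable (past t)"
  shows "indep_pair borel f borel (\<lambda>\<omega>. (\<xi>M t \<omega>, \<xi>b t \<omega>, \<xi>c t \<omega>))"
proof -
  let ?Z = "\<lambda>t \<omega>. (\<xi>M t \<omega>, \<xi>b t \<omega>, \<xi>c t \<omega>)"
  \<comment> \<open>The index blocks \<open>{1..<t}\<close> and \<open>{t}\<close> are disjoint;
    evaluation at \<open>t\<close> then recovers the noise from the singleton block.\<close>
  have "indep_var (PiM {1..<t} (\<lambda>_. borel)) (\<lambda>\<omega>. \<lambda>s\<in>{1..<t}. ?Z s \<omega>)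
      (PiM {t} (\<lambda>_. borel)) (\<lambda>\<omega>. \<lambda>s\<in>{t}. ?Z s \<omega>)"
    using t by (intro indep_var_restrict[OF noise_indep]) auto
  then have "indep_pair borel f borel (\<lambda>\<omega>. (\<lambda>z. z t) (\<lambda>s\<in>{t}. ?Z s \<omega>))"
    by (rule indep_pair_vimage_algebra) (use f in \<open>simp_all add: past_def\<close>)
  then show ?thesis by simp
qed

text \<open>Read off from \<open>indep_pair\<close>, whose definition includes measurability with
  respect to \<open>P\<close>.\<close>

lemma borel_measurable_past:
  fixes f :: "'w \<Rightarrow> 'x::topological_space"
  shows "t \<in> {1..T} \<Longrightarrow> f \<in> borel_measurable (past t) \<Longrightarrow> f \<in> borel_measurable P"
  using indep_pair_past by (auto simp: indep_pair_def)

lemma noise_measurable_past: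
  assumes s: "s \<in> {1..<t}"
  shows "\<xi>M s \<in> borel_measurable (past t)" "\<xi>b s \<in> borel_measurable (past t)"
    "\<xi>c s \<in> borel_measurable (past t)"
proof -
  have "(\<lambda>\<omega>. \<lambda>s\<in>{1..<t}. (\<xi>M s \<omega>, \<xi>b s \<omega>, \<xi>c s \<omega>)) \<in> measurable (past t) (PiM {1..<t} (\<lambda>_. borel))"
    unfolding past_def by (rule measurable_vimage_algebra1) (simp add: space_PiM)
  from measurable_compose[OF this measurable_component_singleton[OF s]]
  have Z: "(\<lambda>\<omega>. (\<xi>M s \<omega>, \<xi>b s \<omega>, \<xi>c s \<omega>)) \<in> borel_measurable (past t)"
    using s by simp
  have c: "continuous_on UNIV (\<lambda>z. fst z)" "continuous_on UNIV (\<lambda>z. fst (snd z))" "continuous_on UNIV (\<lambda>z. snd (snd z))"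
    by (intro continuous_intros)+
  show "\<xi>M s \<in> borel_measurable (past t)" "\<xi>b s \<in> borel_measurable (past t)"
    "\<xi>c s \<in> borel_measurable (past t)"
    using measurable_compose[OF Z borel_measurable_continuous_onI[OF c(1)]]
      measurable_compose[OF Z borel_measurable_continuous_onI[OF c(2)]]
      measurable_compose[OF Z borel_measurable_continuous_onI[OF c(3)]] by simp_all
qed

lemma obs_measurable_past:
  assumes s: "s \<in> {1..<t}" and t: "t \<in> {1..T}"
  shows "Mh s \<in> borel_measurable (past t)" "bh s \<in> borel_measurable (past t)"
    "ch s \<in> borel_measurable (past t)"
proof -
  note [measurable] = noise_measurable_past[OF s]
  have "Mh s = (\<lambda>\<omega>. M + \<xi>M s \<omega>)" "bh s = (\<lambda>\<omega>. b + \<xi>b s \<omega>)" "ch s = (\<lambda>\<omega>. c + \<xi>c s \<omega>)"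
    using obs_M[of s] obs_b[of s] obs_c[of s] s t by auto
  then show "Mh s \<in> borel_measurable (past t)" "bh s \<in> borel_measurable (past t)"
    "ch s \<in> borel_measurable (past t)"
    by simp_all
qed

text \<open>The conditional bounds hold for deterministic vectors, with an exceptional null set that
  may depend on the vector, so a random iterate cannot simply be substituted. They are first
  integrated out here; past-dependent vectors are then inserted by independence.\<close>

lemma nn_integral_obs_le:
  assumes t: "t \<in> {1..T}"
    and g[measurable]: "g \<in> borel_measurable P"
    and le: "AE \<omega> in P. nn_cond_exp P (history P (\<lambda>s \<omega>. (Mh s \<omega>, bh s \<omega>, ch s \<omega>)) (t - 1)) g \<omega> \<le> K"
  shows "(\<integral>\<^sup>+\<omega>. g \<omega> \<partial>P) \<le> K"
proof (rule nn_integral_le_of_nn_cond_exp_le[OF subalgebra_history g le])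
  fix s assume "s \<in> {1..t - 1}"
  then have s[measurable]: "s \<in> {1..T}" using t by auto
  show "(\<lambda>\<omega>. (Mh s \<omega>, bh s \<omega>, ch s \<omega>)) \<in> borel_measurable P"
    using obs_measurable[OF s] by (intro borel_measurable_Pair)
qed

text \<open>Martingale-difference property: once the past vectors \<open>v\<close> and
  \<open>w\<close> are frozen, the noise term has mean zero. The function \<phi> stands for the
  gradient noise of either player.\<close>

lemma expectation_inner_noise_past:
  fixes \<phi> :: "(real^'n^'m) \<times> (real^'m) \<times> (real^'n) \<Rightarrow> 'v::euclidean_space \<Rightarrow> 'd::euclidean_space"
  assumes t: "t \<in> {1..T}"
    and cont: "continuous_on UNIV (\<lambda>p. \<phi> (fst p) (snd p))"
    and mean: "\<And>v. has_bochner_integral P (\<lambda>\<omega>. \<phi> (\<xi>M t \<omega>, \<xi>b t \<omega>, \<xi>c t \<omega>) v) 0"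
    and past: "v \<in> borel_measurable (past t)" "w \<in> borel_measurable (past t)"
    and sq: "square_integrable P (\<lambda>\<omega>. \<phi> (\<xi>M t \<omega>, \<xi>b t \<omega>, \<xi>c t \<omega>) (v \<omega>))" "square_integrable P w"
  shows "expectation (\<lambda>\<omega>. \<phi> (\<xi>M t \<omega>, \<xi>b t \<omega>, \<xi>c t \<omega>) (v \<omega>) \<bullet> w \<omega>) = 0"
proof -
  \<comment> \<open>The two past vectors form one random variable, so a single independence
    statement covers both.\<close>
  let ?h = "\<lambda>p::('v \<times> 'd) \<times> (real^'n^'m) \<times> (real^'m) \<times> (real^'n).
    \<phi> (snd p) (fst (fst p)) \<bullet> snd (fst p)"
  have ind: "indep_pair borel (\<lambda>\<omega>. (v \<omega>, w \<omega>)) borel (\<lambda>\<omega>. (\<xi>M t \<omega>, \<xi>b t \<omega>, \<xi>c t \<omega>))"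
    using past by (intro indep_pair_past t borel_measurable_Pair)
  have "continuous_on UNIV (\<lambda>p::('v \<times> 'd) \<times> (real^'n^'m) \<times> (real^'m) \<times> (real^'n). \<phi> (snd p) (fst (fst p)))"
    using continuous_on_compose2[OF cont, of UNIV "\<lambda>p. (snd p, fst (fst p))"]
    by (simp add: continuous_intros)
  then have "continuous_on UNIV ?h"
    by (intro continuous_intros)
  then have h: "?h \<in> borel_measurable (borel \<Otimes>\<^sub>M borel)"
    unfolding borel_prod by (rule borel_measurable_continuous_onI)
  have "expectation (\<lambda>\<omega>. ?h ((v \<omega>, w \<omega>), (\<xi>M t \<omega>, \<xi>b t \<omega>, \<xi>c t \<omega>))) = 0"
  proof (rule indep_pair_integral_eq_zero[OF ind h])
    show "integrable P (\<lambda>\<omega>. ?h ((v \<omega>, w \<omega>), (\<xi>M t \<omega>, \<xi>b t \<omega>, \<xi>c t \<omega>)))"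
      using square_integrable_inner[OF sq] by simp
    \<comment> \<open>With the past frozen at \<open>x\<close>, the inner product with the fixed
      vector \<open>snd x\<close> commutes with the integral.\<close>
    show "expectation (\<lambda>\<omega>. ?h (x, (\<xi>M t \<omega>, \<xi>b t \<omega>, \<xi>c t \<omega>))) = 0" for x
      using has_bochner_integral_inner_left[OF mean[of "fst x"], of "snd x"]
      by (simp add: has_bochner_integral_iff)
  qed
  then show ?thesis by simp
qed

lemma nn_integral_noise_past_le:
  fixes \<phi> :: "(real^'n^'m) \<times> (real^'m) \<times> (real^'n) \<Rightarrow> 'v::euclidean_space \<Rightarrow> 'd::euclidean_space"
  assumes t: "t \<in> {1..T}"
    and cont: "continuous_on UNIV (\<lambda>p. \<phi> (fst p) (snd p))"
    and le: "\<And>v. (\<integral>\<^sup>+\<omega>. ennreal ((norm (\<phi> (\<xi>M t \<omega>, \<xi>b t \<omega>, \<xi>c t \<omega>) v))\<^sup>2) \<partial>P) \<le> ennreal (K * (norm v)\<^sup>2)"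
    and past: "v \<in> borel_measurable (past t)" and sq: "square_integrable P v" and K: "K \<ge> 0"
  shows "(\<integral>\<^sup>+\<omega>. ennreal ((norm (\<phi> (\<xi>M t \<omega>, \<xi>b t \<omega>, \<xi>c t \<omega>) (v \<omega>)))\<^sup>2) \<partial>P)
    \<le> ennreal (K * expectation (\<lambda>\<omega>. (norm (v \<omega>))\<^sup>2))"
proof -
  let ?h = "\<lambda>p::'v \<times> (real^'n^'m) \<times> (real^'m) \<times> (real^'n). (norm (\<phi> (snd p) (fst p)))\<^sup>2"
  note ind = indep_pair_past[OF t past]
  have "continuous_on UNIV (\<lambda>p::'v \<times> (real^'n^'m) \<times> (real^'m) \<times> (real^'n). \<phi> (snd p) (fst p))"
    using continuous_on_compose2[OF cont, of UNIV "\<lambda>p. (snd p, fst p)"]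
    by (simp add: continuous_intros)
  then have "continuous_on UNIV ?h"
    by (intro continuous_intros)
  then have "?h \<in> borel_measurable (borel \<Otimes>\<^sub>M borel)"
    unfolding borel_prod by (rule borel_measurable_continuous_onI)
  then have h: "(\<lambda>p. ennreal (?h p)) \<in> borel_measurable (borel \<Otimes>\<^sub>M borel)"
    by measurable
  \<comment> \<open>Independence separates the noise variable \<omega>' from \<omega>, so the bound
    for deterministic vectors applies at \<open>v \<omega>\<close>.\<close>
  have "(\<integral>\<^sup>+\<omega>. ennreal ((norm (\<phi> (\<xi>M t \<omega>, \<xi>b t \<omega>, \<xi>c t \<omega>) (v \<omega>)))\<^sup>2) \<partial>P)
      = (\<integral>\<^sup>+\<omega>. (\<integral>\<^sup>+\<omega>'. ennreal ((norm (\<phi> (\<xi>M t \<omega>', \<xi>b t \<omega>', \<xi>c t \<omega>') (v \<omega>)))\<^sup>2) \<partial>P) \<partial>P)"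
    using indep_pair_nn_integral[OF ind h] by simp
  also have "\<dots> \<le> (\<integral>\<^sup>+\<omega>. ennreal (K * (norm (v \<omega>))\<^sup>2) \<partial>P)"
    by (intro nn_integral_mono le)
  also have "\<dots> = ennreal (expectation (\<lambda>\<omega>. K * (norm (v \<omega>))\<^sup>2))"
    using K sq by (intro nn_integral_eq_integral) (auto simp: square_integrable_def)
  finally show ?thesis by simp
qed

text \<open>Square-integrability of a product of two random factors is not automatic; it follows
  from the finite moment bound, which independence extends from fixed vectors to
  \<open>v\<close>.\<close>

lemma obs_mult_past:
  assumes t: "t \<in> {1..T}" and past: "v \<in> borel_measurable (past t)" and sq: "square_integrable P v"
  shows "square_integrable P (\<lambda>\<omega>. Mh t \<omega> *v v \<omega>)"
    and "expectation (\<lambda>\<omega>. (norm (Mh t \<omega> *v v \<omega>))\<^sup>2) \<le> LM\<^sup>2 * expectation (\<lambda>\<omega>. (norm (v \<omega>))\<^sup>2)"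
proof -
  note [measurable] = obs_measurable[OF t] borel_measurable_past[OF t past]
  have "(\<integral>\<^sup>+\<omega>. ennreal ((norm ((M + fst (\<xi>M t \<omega>, \<xi>b t \<omega>, \<xi>c t \<omega>)) *v v \<omega>))\<^sup>2) \<partial>P)
    \<le> ennreal (LM\<^sup>2 * expectation (\<lambda>\<omega>. (norm (v \<omega>))\<^sup>2))"
  \<comment> \<open>The observed matrix is expressed through the noise triple, for which
    independence of the past is known.\<close>
  proof (rule nn_integral_noise_past_le[OF t _ _ past sq, where \<phi> = "\<lambda>z v. (M + fst z) *v v"])
    have "(\<integral>\<^sup>+\<omega>. ennreal ((norm (Mh t \<omega> *v y))\<^sup>2) \<partial>P) \<le> ennreal (LM\<^sup>2 * (norm y)\<^sup>2)" for y
      by (rule nn_integral_obs_le[OF t _ moment_M[OF t]]) measurable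
    then show "(\<integral>\<^sup>+\<omega>. ennreal ((norm ((M + fst (\<xi>M t \<omega>, \<xi>b t \<omega>, \<xi>c t \<omega>)) *v y))\<^sup>2) \<partial>P)
        \<le> ennreal (LM\<^sup>2 * (norm y)\<^sup>2)" for y
      by (simp add: obs_M[OF t])
  qed (auto intro!: continuous_intros)
  then have "(\<integral>\<^sup>+\<omega>. ennreal ((norm (Mh t \<omega> *v v \<omega>))\<^sup>2) \<partial>P)
    \<le> ennreal (LM\<^sup>2 * expectation (\<lambda>\<omega>. (norm (v \<omega>))\<^sup>2))"
    by (simp add: obs_M[OF t])
  from square_integrable_nn_integral_le[OF _ this]
  show "square_integrable P (\<lambda>\<omega>. Mh t \<omega> *v v \<omega>)"
    "expectation (\<lambda>\<omega>. (norm (Mh t \<omega> *v v \<omega>))\<^sup>2) \<le> LM\<^sup>2 * expectation (\<lambda>\<omega>. (norm (v \<omega>))\<^sup>2)"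
    by simp_all
qed

lemma obs_transpose_mult_past:
  assumes t: "t \<in> {1..T}" and past: "v \<in> borel_measurable (past t)" and sq: "square_integrable P v"
  shows "square_integrable P (\<lambda>\<omega>. transpose (Mh t \<omega>) *v v \<omega>)"
    and "expectation (\<lambda>\<omega>. (norm (transpose (Mh t \<omega>) *v v \<omega>))\<^sup>2)
      \<le> LM\<^sup>2 * expectation (\<lambda>\<omega>. (norm (v \<omega>))\<^sup>2)"
proof -
  \<comment> \<open>Products stay in the form \<open>transpose A *v x\<close>, in which the moment
    bounds are stated, rather than \<open>x v* A\<close>.\<close>
  note [simp del] = transpose_matrix_vector
  note [measurable] = obs_measurable[OF t] borel_measurable_past[OF t past]
  have "(\<integral>\<^sup>+\<omega>. ennreal ((norm (transpose (M + fst (\<xi>M t \<omega>, \<xi>b t \<omega>, \<xi>c t \<omega>)) *v v \<omega>))\<^sup>2) \<partial>P)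
    \<le> ennreal (LM\<^sup>2 * expectation (\<lambda>\<omega>. (norm (v \<omega>))\<^sup>2))"
  proof (rule nn_integral_noise_past_le[OF t _ _ past sq, where \<phi> = "\<lambda>z v. transpose (M + fst z) *v v"])
    have "(\<integral>\<^sup>+\<omega>. ennreal ((norm (transpose (Mh t \<omega>) *v x))\<^sup>2) \<partial>P) \<le> ennreal (LM\<^sup>2 * (norm x)\<^sup>2)" for x
      by (rule nn_integral_obs_le[OF t _ moment_Mt[OF t]]) measurable
    then show "(\<integral>\<^sup>+\<omega>. ennreal ((norm (transpose (M + fst (\<xi>M t \<omega>, \<xi>b t \<omega>, \<xi>c t \<omega>)) *v x))\<^sup>2) \<partial>P)
        \<le> ennreal (LM\<^sup>2 * (norm x)\<^sup>2)" for x
      by (simp add: obs_M[OF t])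
  qed (auto intro!: continuous_intros)
  then have "(\<integral>\<^sup>+\<omega>. ennreal ((norm (transpose (Mh t \<omega>) *v v \<omega>))\<^sup>2) \<partial>P)
    \<le> ennreal (LM\<^sup>2 * expectation (\<lambda>\<omega>. (norm (v \<omega>))\<^sup>2))"
    by (simp add: obs_M[OF t])
  from square_integrable_nn_integral_le[OF _ this]
  show "square_integrable P (\<lambda>\<omega>. transpose (Mh t \<omega>) *v v \<omega>)"
    "expectation (\<lambda>\<omega>. (norm (transpose (Mh t \<omega>) *v v \<omega>))\<^sup>2)
      \<le> LM\<^sup>2 * expectation (\<lambda>\<omega>. (norm (v \<omega>))\<^sup>2)"
    by simp_all
qed

lemma obs_b_moment:
  assumes t: "t \<in> {1..T}"
  shows "square_integrable P (bh t)" "expectation (\<lambda>\<omega>. (norm (bh t \<omega>))\<^sup>2) \<le> Lb\<^sup>2"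
proof -
  note [measurable] = obs_measurable[OF t]
  have "(\<integral>\<^sup>+\<omega>. ennreal ((norm (bh t \<omega>))\<^sup>2) \<partial>P) \<le> ennreal (Lb\<^sup>2)"
    by (rule nn_integral_obs_le[OF t _ moment_b[OF t]]) measurable
  from square_integrable_nn_integral_le[OF _ this]
  show "square_integrable P (bh t)" "expectation (\<lambda>\<omega>. (norm (bh t \<omega>))\<^sup>2) \<le> Lb\<^sup>2" by simp_all
qed

lemma obs_c_moment:
  assumes t: "t \<in> {1..T}"
  shows "square_integrable P (ch t)" "expectation (\<lambda>\<omega>. (norm (ch t \<omega>))\<^sup>2) \<le> Lc\<^sup>2"
proof -
  note [measurable] = obs_measurable[OF t]
  have "(\<integral>\<^sup>+\<omega>. ennreal ((norm (ch t \<omega>))\<^sup>2) \<partial>P) \<le> ennreal (Lc\<^sup>2)"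
    by (rule nn_integral_obs_le[OF t _ moment_c[OF t]]) measurable
  from square_integrable_nn_integral_le[OF _ this]
  show "square_integrable P (ch t)" "expectation (\<lambda>\<omega>. (norm (ch t \<omega>))\<^sup>2) \<le> Lc\<^sup>2" by simp_all
qed

text \<open>The error of the gradient at \<open>v\<close> is the noise matrix applied to
  \<open>v\<close> plus the noise vector, which has mean zero for every fixed
  \<open>v\<close>.\<close>

lemma grad_x_noise_orthogonal:
  assumes t: "t \<in> {1..T}" and past: "v \<in> borel_measurable (past t)" "w \<in> borel_measurable (past t)"
    and sq: "square_integrable P v" "square_integrable P w"
  shows "expectation (\<lambda>\<omega>. ((Mh t \<omega> *v v \<omega> + bh t \<omega>) - (M *v v \<omega> + b)) \<bullet> w \<omega>) = 0"
proof -
  have eq: "(Mh t \<omega> *v v \<omega> + bh t \<omega>) - (M *v v \<omega> + b) = \<xi>M t \<omega> *v v \<omega> + \<xi>b t \<omega>" for \<omega>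
    by (simp add: obs_M[OF t] obs_b[OF t] matrix_vector_mult_add_rdistrib)
  \<comment> \<open>The moment bounds concern observations, so the error is shown to be in
    \<open>L^2\<close> as observed minus exact gradient.\<close>
  have "square_integrable P (\<lambda>\<omega>. (Mh t \<omega> *v v \<omega> + bh t \<omega>) - (M *v v \<omega> + b))"
    using obs_mult_past(1)[OF t past(1) sq(1)] obs_b_moment(1)[OF t] square_integrable_bounded_linear[OF sq(1)]
    by (intro square_integrable_diff square_integrable_add square_integrable_const) auto
  then have "expectation (\<lambda>\<omega>. (fst (\<xi>M t \<omega>, \<xi>b t \<omega>, \<xi>c t \<omega>) *v v \<omega> + fst (snd (\<xi>M t \<omega>, \<xi>b t \<omega>, \<xi>c t \<omega>))) \<bullet> w \<omega>) = 0"
    using has_bochner_integral_add[OF has_bochner_integral_bounded_linear[OF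
          bounded_linear_matrix_vector_mult_left noise_mean_M[OF t]] noise_mean_b[OF t]]
    by (intro expectation_inner_noise_past[OF t _ _ past _ sq(2), where \<phi> = "\<lambda>z v. fst z *v v + fst (snd z)"])
      (auto simp: eq intro!: continuous_intros)
  then show ?thesis by (simp add: eq)
qed

text \<open>With the negated gradient of the second player the error is \<open>\<xi>c t \<omega> -
  transpose (\<xi>M t \<omega>) *v v \<omega>\<close>, again centred at each fixed
  \<open>v\<close>.\<close>

lemma grad_y_noise_orthogonal:
  assumes t: "t \<in> {1..T}" and past: "v \<in> borel_measurable (past t)" "w \<in> borel_measurable (past t)"
    and sq: "square_integrable P v" "square_integrable P w"
  shows "expectation (\<lambda>\<omega>. (- (transpose (Mh t \<omega>) *v v \<omega> - ch t \<omega>) - - (transpose M *v v \<omega> - c)) \<bullet> w \<omega>) = 0"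
proof -
  note [simp del] = transpose_matrix_vector
  have tr: "transpose (M + A) *v x = transpose M *v x + transpose A *v x" for A :: "real^'n^'m" and x
    using bounded_linear.linear[OF bounded_linear_transpose_vector_mult_left] by (rule linear_add)
  have eq: "- (transpose (Mh t \<omega>) *v v \<omega> - ch t \<omega>) - - (transpose M *v v \<omega> - c)
      = \<xi>c t \<omega> - transpose (\<xi>M t \<omega>) *v v \<omega>" for \<omega>
    by (simp add: obs_M[OF t] obs_c[OF t] tr)
  have "square_integrable P (\<lambda>\<omega>. - (transpose (Mh t \<omega>) *v v \<omega> - ch t \<omega>) - - (transpose M *v v \<omega> - c))"
    using obs_transpose_mult_past(1)[OF t past(1) sq(1)] obs_c_moment(1)[OF t] square_integrable_bounded_linear[OF sq(1)]
    by (intro square_integrable_diff square_integrable_uminus square_integrable_const) auto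
  then have "square_integrable P (\<lambda>\<omega>. \<xi>c t \<omega> - transpose (\<xi>M t \<omega>) *v v \<omega>)"
    unfolding eq .
  then have "expectation (\<lambda>\<omega>. (snd (snd (\<xi>M t \<omega>, \<xi>b t \<omega>, \<xi>c t \<omega>)) - transpose (fst (\<xi>M t \<omega>, \<xi>b t \<omega>, \<xi>c t \<omega>)) *v v \<omega>) \<bullet> w \<omega>) = 0"
    using has_bochner_integral_diff[OF noise_mean_c[OF t] has_bochner_integral_bounded_linear[OF
          bounded_linear_transpose_vector_mult_left noise_mean_M[OF t]]]
    by (intro expectation_inner_noise_past[OF t _ _ past _ sq(2), where \<phi> = "\<lambda>z v. snd (snd z) - transpose (fst z) *v v"])
      (auto simp: linear_0[OF bounded_linear.linear[OF bounded_linear_transpose_vector_mult_left]] intro!: continuous_intros)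
  then show ?thesis unfolding eq by simp
qed

section \<open>The iterates and their stochastic gradients\<close>

abbreviation "iterate \<eta>x \<eta>y \<rho>x \<rho>y x1 y1 t \<omega> \<equiv>
  cogda \<eta>x \<eta>y \<rho>x \<rho>y x1 y1 (\<lambda>t. Mh t \<omega>) (\<lambda>t. bh t \<omega>) (\<lambda>t. ch t \<omega>) t"

text \<open>Iterate \<open>k\<close> uses only observations of rounds before \<open>k\<close>, hence
  before \<open>t\<close>; equality \<open>k = t\<close> is allowed, so the current iterate is
  independent of the current noise.\<close>

lemma iterate_measurable_past:
  assumes t: "t \<in> {1..T}" and k: "1 \<le> k" "k \<le> t"
  shows "(\<lambda>\<omega>. fst (iterate \<eta>x \<eta>y \<rho>x \<rho>y x1 y1 k \<omega>)) \<in> borel_measurable (past t)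
    \<and> (\<lambda>\<omega>. snd (iterate \<eta>x \<eta>y \<rho>x \<rho>y x1 y1 k \<omega>)) \<in> borel_measurable (past t)"
  using k
proof (induction k rule: dec_induct)
  case base
  then show ?case by simp
next
  case (step k)
  have "k \<in> {1..<t}" using step by simp
  note [measurable] = obs_measurable_past[OF this t]
  have [measurable]: "(\<lambda>\<omega>. fst (iterate \<eta>x \<eta>y \<rho>x \<rho>y x1 y1 k \<omega>)) \<in> borel_measurable (past t)"
    "(\<lambda>\<omega>. snd (iterate \<eta>x \<eta>y \<rho>x \<rho>y x1 y1 k \<omega>)) \<in> borel_measurable (past t)"
    using step by simp_all
  show ?case
    unfolding cogda_Suc[OF \<open>1 \<le> k\<close>] by (intro conjI) measurable
qed

text \<open>Induction over rounds: the iterate is a past vector, so its product with the fresh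
  observed matrix stays in \<open>L^2\<close>.\<close>

lemma iterate_square_integrable:
  assumes "1 \<le> t" "t \<le> T"
  shows "square_integrable P (\<lambda>\<omega>. fst (iterate \<eta>x \<eta>y \<rho>x \<rho>y x1 y1 t \<omega>))
    \<and> square_integrable P (\<lambda>\<omega>. snd (iterate \<eta>x \<eta>y \<rho>x \<rho>y x1 y1 t \<omega>))"
  using assms
proof (induction t rule: dec_induct)
  case base
  then show ?case by (simp add: square_integrable_const)
next
  case (step t)
  then have t: "t \<in> {1..T}" by simp
  have past: "(\<lambda>\<omega>. fst (iterate \<eta>x \<eta>y \<rho>x \<rho>y x1 y1 t \<omega>)) \<in> borel_measurable (past t)"
    "(\<lambda>\<omega>. snd (iterate \<eta>x \<eta>y \<rho>x \<rho>y x1 y1 t \<omega>)) \<in> borel_measurable (past t)"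
    using iterate_measurable_past[OF t, of t] t by auto
  have sq: "square_integrable P (\<lambda>\<omega>. fst (iterate \<eta>x \<eta>y \<rho>x \<rho>y x1 y1 t \<omega>))"
    "square_integrable P (\<lambda>\<omega>. snd (iterate \<eta>x \<eta>y \<rho>x \<rho>y x1 y1 t \<omega>))"
    using step by simp_all
  show ?case
    unfolding cogda_Suc[OF \<open>1 \<le> t\<close>]
    by (intro conjI square_integrable_scaleR square_integrable_add square_integrable_diff
        square_integrable_uminus square_integrable_const sq obs_mult_past(1)[OF t past(2) sq(2)]
        obs_transpose_mult_past(1)[OF t past(1) sq(1)] obs_b_moment(1)[OF t] obs_c_moment(1)[OF t])
qed

text \<open>The gradient is split at the fixed point \<open>y\<close>. The part with
  \<open>v - y\<close> is the growth that anchoring must absorb; the other part is evaluated at a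
  deterministic point and survives in the final bound.\<close>

lemma grad_x_second_moment:
  assumes t: "t \<in> {1..T}" and past: "v \<in> borel_measurable (past t)" and sq: "square_integrable P v"
  shows "expectation (\<lambda>\<omega>. (norm (Mh t \<omega> *v v \<omega> + bh t \<omega>))\<^sup>2)
    \<le> 2 * LM\<^sup>2 * expectation (\<lambda>\<omega>. (norm (v \<omega> - y))\<^sup>2) + 2 * expectation (\<lambda>\<omega>. (norm (Mh t \<omega> *v y + bh t \<omega>))\<^sup>2)"
proof -
  have past': "(\<lambda>\<omega>. v \<omega> - y) \<in> borel_measurable (past t)" using past by simp
  have sq': "square_integrable P (\<lambda>\<omega>. v \<omega> - y)"
    by (intro square_integrable_diff sq square_integrable_const)
  note A = obs_mult_past[OF t past' sq']
  have B: "square_integrable P (\<lambda>\<omega>. Mh t \<omega> *v y + bh t \<omega>)"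
    by (intro square_integrable_add obs_mult_past(1) t obs_b_moment square_integrable_const) simp
  have C: "square_integrable P (\<lambda>\<omega>. Mh t \<omega> *v v \<omega> + bh t \<omega>)"
    by (intro square_integrable_add obs_mult_past(1) t obs_b_moment past sq)
  have "expectation (\<lambda>\<omega>. (norm (Mh t \<omega> *v v \<omega> + bh t \<omega>))\<^sup>2)
    \<le> expectation (\<lambda>\<omega>. 2 * (norm (Mh t \<omega> *v (v \<omega> - y)))\<^sup>2 + 2 * (norm (Mh t \<omega> *v y + bh t \<omega>))\<^sup>2)"
  proof (rule integral_mono)
    show "(norm (Mh t \<omega> *v v \<omega> + bh t \<omega>))\<^sup>2
      \<le> 2 * (norm (Mh t \<omega> *v (v \<omega> - y)))\<^sup>2 + 2 * (norm (Mh t \<omega> *v y + bh t \<omega>))\<^sup>2" for \<omega>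
      using norm_add_square_le[of "Mh t \<omega> *v (v \<omega> - y)" "Mh t \<omega> *v y + bh t \<omega>"]
      by (simp add: matrix_vector_mult_diff_distrib)
  qed (use A(1) B C in \<open>auto simp: square_integrable_integrable\<close>)
  also have "\<dots> = 2 * expectation (\<lambda>\<omega>. (norm (Mh t \<omega> *v (v \<omega> - y)))\<^sup>2)
      + 2 * expectation (\<lambda>\<omega>. (norm (Mh t \<omega> *v y + bh t \<omega>))\<^sup>2)"
    using A(1) B by (simp add: square_integrable_integrable)
  finally show ?thesis using A(2) by simp
qed

lemma grad_y_second_moment:
  assumes t: "t \<in> {1..T}" and past: "v \<in> borel_measurable (past t)" and sq: "square_integrable P v"
  shows "expectation (\<lambda>\<omega>. (norm (- (transpose (Mh t \<omega>) *v v \<omega> - ch t \<omega>)))\<^sup>2)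
    \<le> 2 * LM\<^sup>2 * expectation (\<lambda>\<omega>. (norm (v \<omega> - x))\<^sup>2)
      + 2 * expectation (\<lambda>\<omega>. (norm (transpose (Mh t \<omega>) *v x - ch t \<omega>))\<^sup>2)"
proof -
  note [simp del] = transpose_matrix_vector
  have past': "(\<lambda>\<omega>. v \<omega> - x) \<in> borel_measurable (past t)" using past by simp
  have sq': "square_integrable P (\<lambda>\<omega>. v \<omega> - x)"
    by (intro square_integrable_diff sq square_integrable_const)
  note A = obs_transpose_mult_past[OF t past' sq']
  have B: "square_integrable P (\<lambda>\<omega>. transpose (Mh t \<omega>) *v x - ch t \<omega>)"
    by (intro square_integrable_diff obs_transpose_mult_past(1) t obs_c_moment square_integrable_const) simp
  have C: "square_integrable P (\<lambda>\<omega>. - (transpose (Mh t \<omega>) *v v \<omega> - ch t \<omega>))"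
    by (intro square_integrable_uminus square_integrable_diff obs_transpose_mult_past(1) t obs_c_moment past sq)
  have "expectation (\<lambda>\<omega>. (norm (- (transpose (Mh t \<omega>) *v v \<omega> - ch t \<omega>)))\<^sup>2)
    \<le> expectation (\<lambda>\<omega>. 2 * (norm (transpose (Mh t \<omega>) *v (v \<omega> - x)))\<^sup>2
        + 2 * (norm (transpose (Mh t \<omega>) *v x - ch t \<omega>))\<^sup>2)"
  proof (rule integral_mono)
    show "(norm (- (transpose (Mh t \<omega>) *v v \<omega> - ch t \<omega>)))\<^sup>2
      \<le> 2 * (norm (transpose (Mh t \<omega>) *v (v \<omega> - x)))\<^sup>2 + 2 * (norm (transpose (Mh t \<omega>) *v x - ch t \<omega>))\<^sup>2" for \<omega>
      using norm_add_square_le[of "transpose (Mh t \<omega>) *v (v \<omega> - x)" "transpose (Mh t \<omega>) *v x - ch t \<omega>"]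
      by (simp only: norm_minus_cancel) (simp add: matrix_vector_mult_diff_distrib)
  qed (use A(1) B C in \<open>auto simp: square_integrable_integrable simp del: norm_minus_cancel minus_diff_eq\<close>)
  also have "\<dots> = 2 * expectation (\<lambda>\<omega>. (norm (transpose (Mh t \<omega>) *v (v \<omega> - x)))\<^sup>2)
      + 2 * expectation (\<lambda>\<omega>. (norm (transpose (Mh t \<omega>) *v x - ch t \<omega>))\<^sup>2)"
    using A(1) B by (simp add: square_integrable_integrable)
  finally show ?thesis using A(2) by simp
qed

lemma expected_gap_bound:
  assumes T: "T \<ge> 1" and \<eta>: "\<eta>x > 0" "\<eta>y > 0" and comp: "adaptive_comparator P x1 y1 xs ys"
  defines "\<rho>x \<equiv> 4 * \<eta>y * LM\<^sup>2" and "\<rho>y \<equiv> 4 * \<eta>x * LM\<^sup>2"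
  defines "G \<equiv> (\<lambda>\<omega>. cogda_gap M b c \<eta>x \<eta>y \<rho>x \<rho>y x1 y1
      (\<lambda>t. Mh t \<omega>) (\<lambda>t. bh t \<omega>) (\<lambda>t. ch t \<omega>) T (xs \<omega>) (ys \<omega>))"
  shows "integrable P G"
    and "expectation G \<le> (1 / (\<eta>y * real T) + 2 * \<eta>x * LM\<^sup>2) * expectation (\<lambda>\<omega>. (norm (ys \<omega> - y1))\<^sup>2)
      + (1 / (\<eta>x * real T) + 2 * \<eta>y * LM\<^sup>2) * expectation (\<lambda>\<omega>. (norm (xs \<omega> - x1))\<^sup>2)
      + 2 * \<eta>y / real T * (\<Sum>t=1..T. expectation (\<lambda>\<omega>. (norm (transpose (Mh t \<omega>) *v x1 - ch t \<omega>))\<^sup>2))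
      + 2 * \<eta>x / real T * (\<Sum>t=1..T. expectation (\<lambda>\<omega>. (norm (Mh t \<omega> *v y1 + bh t \<omega>))\<^sup>2))"
proof -
  note [simp del] = transpose_matrix_vector
  define X where "X t \<omega> = fst (iterate \<eta>x \<eta>y \<rho>x \<rho>y x1 y1 t \<omega>)" for t \<omega>
  define Y where "Y t \<omega> = snd (iterate \<eta>x \<eta>y \<rho>x \<rho>y x1 y1 t \<omega>)" for t \<omega>
  define hx where "hx t \<omega> = Mh t \<omega> *v Y t \<omega> + bh t \<omega>" for t \<omega>
  define gx where "gx t \<omega> = M *v Y t \<omega> + b" for t \<omega>
  \<comment> \<open>The negated ascent direction, so that both players minimize.\<close>
  define hy where "hy t \<omega> = - (transpose (Mh t \<omega>) *v X t \<omega> - ch t \<omega>)" for t \<omega>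
  define gy where "gy t \<omega> = - (transpose M *v X t \<omega> - c)" for t \<omega>
  have \<rho>: "\<rho>x \<ge> 0" "\<rho>y \<ge> 0" using \<eta> by (simp_all add: \<rho>x_def \<rho>y_def)
  have past: "X s \<in> borel_measurable (past t)" "Y s \<in> borel_measurable (past t)"
    if "t \<in> {1..T}" "1 \<le> s" "s \<le> t" for s t
    using iterate_measurable_past[OF that] unfolding X_def Y_def by auto
  have sq: "square_integrable P (X t)" "square_integrable P (Y t)" if "t \<in> {1..T}" for t
    using iterate_square_integrable[of t] that unfolding X_def Y_def by auto
  have sqh: "square_integrable P (hx t)" "square_integrable P (hy t)" if t: "t \<in> {1..T}" for t
  proof -
    have pt: "X t \<in> borel_measurable (past t)" "Y t \<in> borel_measurable (past t)"
      using past[OF t, of t] t by auto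
    show "square_integrable P (hx t)" "square_integrable P (hy t)"
      unfolding hx_def[abs_def] hy_def[abs_def]
      by (intro square_integrable_add square_integrable_uminus square_integrable_diff
          obs_mult_past(1)[OF t pt(2) sq(2)[OF t]] obs_transpose_mult_past(1)[OF t pt(1) sq(1)[OF t]]
          obs_b_moment(1)[OF t] obs_c_moment(1)[OF t])+
  qed
  have sqg: "square_integrable P (gx t)" "square_integrable P (gy t)" if t: "t \<in> {1..T}" for t
    unfolding gx_def[abs_def] gy_def[abs_def]
    by (intro square_integrable_add square_integrable_uminus square_integrable_diff
        square_integrable_bounded_linear[OF sq(2)[OF t]] square_integrable_bounded_linear[OF sq(1)[OF t]]
        square_integrable_const matrix_vector_mul_bounded_linear)+
  have pg: "gx s \<in> borel_measurable (past t)" "gy s \<in> borel_measurable (past t)"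
    if "t \<in> {1..T}" "1 \<le> s" "s \<le> t" for s t
  proof -
    note [measurable] = past[OF that]
    show "gx s \<in> borel_measurable (past t)" "gy s \<in> borel_measurable (past t)"
      unfolding gx_def[abs_def] gy_def[abs_def] by measurable
  qed
  \<comment> \<open>Strictly earlier here: \<open>hx s\<close> and \<open>hy s\<close> use the
    observation of round \<open>s\<close>, while \<open>X s\<close>, \<open>Y s\<close> and the
    exact gradients stop before it.\<close>
  have ph: "hx s \<in> borel_measurable (past t)" "hy s \<in> borel_measurable (past t)"
    if t: "t \<in> {1..T}" and s: "1 \<le> s" "s < t" for s t
  proof -
    have [measurable]: "X s \<in> borel_measurable (past t)" "Y s \<in> borel_measurable (past t)"
      using past[OF t, of s] s by auto
    have "s \<in> {1..<t}" using s by simp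
    note [measurable] = obs_measurable_past[OF this t]
    show "hx s \<in> borel_measurable (past t)" "hy s \<in> borel_measurable (past t)"
      unfolding hx_def[abs_def] hy_def[abs_def] by measurable
  qed
  \<comment> \<open>The comparators are only given as square-integrable deviations; constants lie in
    \<open>L^2\<close> of a probability space and can be added back.\<close>
  have sqxs: "square_integrable P xs" and sqys: "square_integrable P ys"
  proof -
    have "square_integrable P (\<lambda>\<omega>. xs \<omega> - x1)" "square_integrable P (\<lambda>\<omega>. ys \<omega> - y1)"
      using comp by (auto simp: adaptive_comparator_def square_integrable_def)
    from this[THEN square_integrable_add, OF square_integrable_const]
    have "square_integrable P (\<lambda>\<omega>. xs \<omega> - x1 + x1)" "square_integrable P (\<lambda>\<omega>. ys \<omega> - y1 + y1)"
      by blast+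
    then show "square_integrable P xs" "square_integrable P ys" by simp_all
  qed
  have orth_x: "expectation (\<lambda>\<omega>. (hx t \<omega> - gx t \<omega>) \<bullet> w \<omega>) = 0"
    if t: "t \<in> {1..T}" and w: "w \<in> borel_measurable (past t)" "square_integrable P w" for t w
    unfolding hx_def gx_def using t by (intro grad_x_noise_orthogonal t past sq w) auto
  have orth_y: "expectation (\<lambda>\<omega>. (hy t \<omega> - gy t \<omega>) \<bullet> w \<omega>) = 0"
    if t: "t \<in> {1..T}" and w: "w \<in> borel_measurable (past t)" "square_integrable P w" for t w
    unfolding hy_def gy_def using t by (intro grad_y_noise_orthogonal t past sq w) auto
  have regret_x: "(\<Sum>t=1..T. expectation (\<lambda>\<omega>. gx t \<omega> \<bullet> (X t \<omega> - xs \<omega>)))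
      + \<rho>x / 2 * (\<Sum>t=1..T. expectation (\<lambda>\<omega>. (norm (X t \<omega> - x1))\<^sup>2))
    \<le> (\<rho>x * real T / 2 + 1 / \<eta>x) * expectation (\<lambda>\<omega>. (norm (xs \<omega> - x1))\<^sup>2)
      + \<eta>x * (\<Sum>t=1..T. expectation (\<lambda>\<omega>. (norm (hx t \<omega>))\<^sup>2))"
  proof (rule adaptive_regret_bound[OF \<eta>(1) \<rho>(1) _ _ sq(1) sqg(1) sqh(1) sqxs])
    show "X 1 \<omega> = x1" for \<omega> by (simp add: X_def)
    show "X (Suc t) \<omega> = (X t \<omega> - \<eta>x *\<^sub>R hx t \<omega> + (\<rho>x * \<eta>x) *\<^sub>R x1) /\<^sub>R (1 + \<rho>x * \<eta>x)"
      if "t \<in> {1..T}" for t \<omega>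
      using that unfolding X_def hx_def Y_def by (intro cogda_Suc) simp
    show "expectation (\<lambda>\<omega>. (hx t \<omega> - gx t \<omega>) \<bullet> (X t \<omega> - x1)) = 0" if t: "t \<in> {1..T}" for t
      using t past(1)[OF t] sq(1)[OF t]
      by (intro orth_x) (auto intro!: square_integrable_diff square_integrable_const)
    show "expectation (\<lambda>\<omega>. (hx t \<omega> - gx t \<omega>) \<bullet> gx t \<omega>) = 0" if t: "t \<in> {1..T}" for t
      using t by (intro orth_x pg sqg) auto
    \<comment> \<open>The gradient error of the earlier round \<open>s\<close> is itself a past
      vector for round \<open>t\<close>.\<close>
    show "expectation (\<lambda>\<omega>. (hx s \<omega> - gx s \<omega>) \<bullet> (hx t \<omega> - gx t \<omega>)) = 0"
      if st: "1 \<le> s" "s < t" "t \<le> T" for s t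
      using orth_x[of t "\<lambda>\<omega>. hx s \<omega> - gx s \<omega>"] ph(1)[of t s] pg(1)[of t s] sqh(1)[of s] sqg(1)[of s] st
      by (simp add: inner_commute square_integrable_diff)
  qed
  have regret_y: "(\<Sum>t=1..T. expectation (\<lambda>\<omega>. gy t \<omega> \<bullet> (Y t \<omega> - ys \<omega>)))
      + \<rho>y / 2 * (\<Sum>t=1..T. expectation (\<lambda>\<omega>. (norm (Y t \<omega> - y1))\<^sup>2))
    \<le> (\<rho>y * real T / 2 + 1 / \<eta>y) * expectation (\<lambda>\<omega>. (norm (ys \<omega> - y1))\<^sup>2)
      + \<eta>y * (\<Sum>t=1..T. expectation (\<lambda>\<omega>. (norm (hy t \<omega>))\<^sup>2))"
  proof (rule adaptive_regret_bound[OF \<eta>(2) \<rho>(2) _ _ sq(2) sqg(2) sqh(2) sqys])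
    show "Y 1 \<omega> = y1" for \<omega> by (simp add: Y_def)
    show "Y (Suc t) \<omega> = (Y t \<omega> - \<eta>y *\<^sub>R hy t \<omega> + (\<rho>y * \<eta>y) *\<^sub>R y1) /\<^sub>R (1 + \<rho>y * \<eta>y)"
      if "t \<in> {1..T}" for t \<omega>
      using that unfolding X_def hy_def Y_def by (intro cogda_Suc) simp
    show "expectation (\<lambda>\<omega>. (hy t \<omega> - gy t \<omega>) \<bullet> (Y t \<omega> - y1)) = 0" if t: "t \<in> {1..T}" for t
      using t past(2)[OF t] sq(2)[OF t]
      by (intro orth_y) (auto intro!: square_integrable_diff square_integrable_const)
    show "expectation (\<lambda>\<omega>. (hy t \<omega> - gy t \<omega>) \<bullet> gy t \<omega>) = 0" if t: "t \<in> {1..T}" for t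
      using t by (intro orth_y pg sqg) auto
    show "expectation (\<lambda>\<omega>. (hy s \<omega> - gy s \<omega>) \<bullet> (hy t \<omega> - gy t \<omega>)) = 0"
      if st: "1 \<le> s" "s < t" "t \<le> T" for s t
      using orth_y[of t "\<lambda>\<omega>. hy s \<omega> - gy s \<omega>"] ph(2)[of t s] pg(2)[of t s] sqh(2)[of s] sqg(2)[of s] st
      by (simp add: inner_commute square_integrable_diff)
  qed

  \<comment> \<open>Cancellation of the growth terms\<close>
  define Dx where "Dx = expectation (\<lambda>\<omega>. (norm (xs \<omega> - x1))\<^sup>2)"
  define Dy where "Dy = expectation (\<lambda>\<omega>. (norm (ys \<omega> - y1))\<^sup>2)"
  define VX where "VX = (\<Sum>t=1..T. expectation (\<lambda>\<omega>. (norm (X t \<omega> - x1))\<^sup>2))"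
  define VY where "VY = (\<Sum>t=1..T. expectation (\<lambda>\<omega>. (norm (Y t \<omega> - y1))\<^sup>2))"
  define Nx where "Nx = (\<Sum>t=1..T. expectation (\<lambda>\<omega>. (norm (Mh t \<omega> *v y1 + bh t \<omega>))\<^sup>2))"
  define Ny where "Ny = (\<Sum>t=1..T. expectation (\<lambda>\<omega>. (norm (transpose (Mh t \<omega>) *v x1 - ch t \<omega>))\<^sup>2))"
  define Rx where "Rx = (\<Sum>t=1..T. expectation (\<lambda>\<omega>. gx t \<omega> \<bullet> (X t \<omega> - xs \<omega>)))"
  define Ry where "Ry = (\<Sum>t=1..T. expectation (\<lambda>\<omega>. gy t \<omega> \<bullet> (Y t \<omega> - ys \<omega>)))"
  \<comment> \<open>The gradients of one player grow with the deviation of the other: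
    \<open>hx\<close> brings in \<open>VY\<close>, and below \<open>hy\<close> brings in
    \<open>VX\<close>.\<close>
  have "(\<Sum>t=1..T. expectation (\<lambda>\<omega>. (norm (hx t \<omega>))\<^sup>2)) \<le> 2 * LM\<^sup>2 * VY + 2 * Nx"
    unfolding VY_def Nx_def hx_def sum_distrib_left sum.distrib[symmetric]
    by (intro sum_mono grad_x_second_moment past sq) auto
  then have "\<eta>x * (\<Sum>t=1..T. expectation (\<lambda>\<omega>. (norm (hx t \<omega>))\<^sup>2)) \<le> \<eta>x * (2 * LM\<^sup>2 * VY + 2 * Nx)"
    using \<eta> by (intro mult_left_mono) auto
  with regret_x have Rx: "Rx + \<rho>x / 2 * VX \<le> (\<rho>x * real T / 2 + 1 / \<eta>x) * Dx + \<eta>x * (2 * LM\<^sup>2 * VY + 2 * Nx)"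
    unfolding Rx_def VX_def Dx_def by linarith
  have "(\<Sum>t=1..T. expectation (\<lambda>\<omega>. (norm (hy t \<omega>))\<^sup>2)) \<le> 2 * LM\<^sup>2 * VX + 2 * Ny"
    unfolding VX_def Ny_def hy_def sum_distrib_left sum.distrib[symmetric]
    by (intro sum_mono grad_y_second_moment past sq) auto
  then have "\<eta>y * (\<Sum>t=1..T. expectation (\<lambda>\<omega>. (norm (hy t \<omega>))\<^sup>2)) \<le> \<eta>y * (2 * LM\<^sup>2 * VX + 2 * Ny)"
    using \<eta> by (intro mult_left_mono) auto
  with regret_y have Ry: "Ry + \<rho>y / 2 * VY \<le> (\<rho>y * real T / 2 + 1 / \<eta>y) * Dy + \<eta>y * (2 * LM\<^sup>2 * VX + 2 * Ny)"
    unfolding Ry_def VY_def Dy_def by linarith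
  \<comment> \<open>\<open>\<rho>x / 2 = 2 * \<eta>y * LM\<^sup>2\<close> and
    \<open>\<rho>y / 2 = 2 * \<eta>x * LM\<^sup>2\<close>, so \<open>VX\<close> and
    \<open>VY\<close> have equal coefficients on both sides and drop out.\<close>
  have total: "Rx + Ry \<le> (2 * \<eta>y * LM\<^sup>2 * real T + 1 / \<eta>x) * Dx + (2 * \<eta>x * LM\<^sup>2 * real T + 1 / \<eta>y) * Dy
      + 2 * \<eta>x * Nx + 2 * \<eta>y * Ny"
    using Rx Ry by (simp add: \<rho>x_def \<rho>y_def algebra_simps)
  have G: "G = (\<lambda>\<omega>. ((\<Sum>t=1..T. gx t \<omega> \<bullet> (X t \<omega> - xs \<omega>)) + (\<Sum>t=1..T. gy t \<omega> \<bullet> (Y t \<omega> - ys \<omega>))) / real T)"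
    unfolding G_def cogda_gap_def cogda_xbar_def cogda_ybar_def saddle_gap_average[OF T]
    by (simp add: gx_def gy_def X_def Y_def del: minus_diff_eq)
  have "has_bochner_integral P G ((Rx + Ry) / real T)"
    unfolding G Rx_def Ry_def
    by (intro has_bochner_integral_divide has_bochner_integral_add has_bochner_integral_sum
        has_bochner_integral_integrable square_integrable_inner square_integrable_diff sqg sq sqxs sqys)
  then show "integrable P G" and "expectation G \<le> (1 / (\<eta>y * real T) + 2 * \<eta>x * LM\<^sup>2) * expectation (\<lambda>\<omega>. (norm (ys \<omega> - y1))\<^sup>2)
      + (1 / (\<eta>x * real T) + 2 * \<eta>y * LM\<^sup>2) * expectation (\<lambda>\<omega>. (norm (xs \<omega> - x1))\<^sup>2)
      + 2 * \<eta>y / real T * (\<Sum>t=1..T. expectation (\<lambda>\<omega>. (norm (transpose (Mh t \<omega>) *v x1 - ch t \<omega>))\<^sup>2))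
      + 2 * \<eta>x / real T * (\<Sum>t=1..T. expectation (\<lambda>\<omega>. (norm (Mh t \<omega> *v y1 + bh t \<omega>))\<^sup>2))"
  proof -
    assume hb: "has_bochner_integral P G ((Rx + Ry) / real T)"
    then show "integrable P G" by (simp add: has_bochner_integral_iff)
    have "expectation G = (Rx + Ry) / real T" using hb by (simp add: has_bochner_integral_iff)
    also have "\<dots> \<le> ((2 * \<eta>y * LM\<^sup>2 * real T + 1 / \<eta>x) * Dx + (2 * \<eta>x * LM\<^sup>2 * real T + 1 / \<eta>y) * Dy
      + 2 * \<eta>x * Nx + 2 * \<eta>y * Ny) / real T"
      using total by (intro divide_right_mono) auto
    also have "\<dots> = (1 / (\<eta>y * real T) + 2 * \<eta>x * LM\<^sup>2) * Dy + (1 / (\<eta>x * real T) + 2 * \<eta>y * LM\<^sup>2) * Dx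
      + 2 * \<eta>y / real T * Ny + 2 * \<eta>x / real T * Nx"
      using T \<eta> by (simp add: field_simps)
    finally show "expectation G \<le> (1 / (\<eta>y * real T) + 2 * \<eta>x * LM\<^sup>2) * expectation (\<lambda>\<omega>. (norm (ys \<omega> - y1))\<^sup>2)
      + (1 / (\<eta>x * real T) + 2 * \<eta>y * LM\<^sup>2) * expectation (\<lambda>\<omega>. (norm (xs \<omega> - x1))\<^sup>2)
      + 2 * \<eta>y / real T * (\<Sum>t=1..T. expectation (\<lambda>\<omega>. (norm (transpose (Mh t \<omega>) *v x1 - ch t \<omega>))\<^sup>2))
      + 2 * \<eta>x / real T * (\<Sum>t=1..T. expectation (\<lambda>\<omega>. (norm (Mh t \<omega> *v y1 + bh t \<omega>))\<^sup>2))"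
      unfolding Dx_def Dy_def Nx_def Ny_def .
  qed
qed

text \<open>This step size balances \<open>1 / (\<eta> * real T)\<close> against
  \<open>2 * \<eta> * LM\<^sup>2\<close>: with \<open>r = LM * sqrt (real T)\<close> both equal
  \<open>sqrt 2 * LM\<^sup>2 / r\<close>, and their sum gives the constant
  \<open>2 * sqrt 2\<close>.\<close>

lemma expected_gap_bound_uniform_step:
  assumes T: "T \<ge> 1" and comp: "adaptive_comparator P 0 0 xs ys"
  defines "\<eta> \<equiv> 1 / (LM * sqrt (2 * real T))"
  defines "\<rho> \<equiv> 4 * \<eta> * LM\<^sup>2"
  shows "expectation (\<lambda>\<omega>. cogda_gap M b c \<eta> \<eta> \<rho> \<rho> 0 0
      (\<lambda>t. Mh t \<omega>) (\<lambda>t. bh t \<omega>) (\<lambda>t. ch t \<omega>) T (xs \<omega>) (ys \<omega>))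
    \<le> 2 * sqrt 2 * ((LM\<^sup>2 * expectation (\<lambda>\<omega>. (norm (ys \<omega>))\<^sup>2 + (norm (xs \<omega>))\<^sup>2) + Lb\<^sup>2 + Lc\<^sup>2)
        / (LM * sqrt (real T)))" (is "?E \<le> _")
proof -
  define r where "r = LM * sqrt (real T)"
  define D where "D = expectation (\<lambda>\<omega>. (norm (ys \<omega>))\<^sup>2 + (norm (xs \<omega>))\<^sup>2)"
  have r: "r > 0" using T LM_pos by (simp add: r_def)
  have r2: "r * r = LM\<^sup>2 * real T" by (simp add: r_def power2_eq_square)
  have \<eta>r: "\<eta> = 1 / (sqrt 2 * r)" by (simp add: \<eta>_def r_def real_sqrt_mult)
  have \<eta>: "\<eta> > 0" and \<eta>2: "2 * \<eta> = sqrt 2 / r" unfolding \<eta>r using r by (simp_all add: field_simps)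
  have int: "integrable P (\<lambda>\<omega>. (norm (xs \<omega>))\<^sup>2)" "integrable P (\<lambda>\<omega>. (norm (ys \<omega>))\<^sup>2)"
    using comp by (simp_all add: adaptive_comparator_def)
  \<comment> \<open>At the zero starting point the stochastic gradients reduce to
    \<open>- ch t \<omega>\<close> and \<open>bh t \<omega>\<close>, so only \<open>Lc\<close> and
    \<open>Lb\<close> enter.\<close>
  have Nc: "(\<Sum>t=1..T. expectation (\<lambda>\<omega>. (norm (transpose (Mh t \<omega>) *v 0 - ch t \<omega>))\<^sup>2)) \<le> (\<Sum>t=1..T. Lc\<^sup>2)"
    using obs_c_moment(2) by (intro sum_mono) simp
  have Nb: "(\<Sum>t=1..T. expectation (\<lambda>\<omega>. (norm (Mh t \<omega> *v 0 + bh t \<omega>))\<^sup>2)) \<le> (\<Sum>t=1..T. Lb\<^sup>2)"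
    using obs_b_moment(2) by (intro sum_mono) simp
  have "?E \<le> (1 / (\<eta> * real T) + 2 * \<eta> * LM\<^sup>2) * expectation (\<lambda>\<omega>. (norm (ys \<omega>))\<^sup>2)
      + (1 / (\<eta> * real T) + 2 * \<eta> * LM\<^sup>2) * expectation (\<lambda>\<omega>. (norm (xs \<omega>))\<^sup>2)
      + 2 * \<eta> / real T * (\<Sum>t=1..T. expectation (\<lambda>\<omega>. (norm (transpose (Mh t \<omega>) *v 0 - ch t \<omega>))\<^sup>2))
      + 2 * \<eta> / real T * (\<Sum>t=1..T. expectation (\<lambda>\<omega>. (norm (Mh t \<omega> *v 0 + bh t \<omega>))\<^sup>2))"
    using expected_gap_bound(2)[OF T \<eta> \<eta> comp] unfolding \<rho>_def by simp
  also have "\<dots> \<le> (1 / (\<eta> * real T) + 2 * \<eta> * LM\<^sup>2) * expectation (\<lambda>\<omega>. (norm (ys \<omega>))\<^sup>2)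
      + (1 / (\<eta> * real T) + 2 * \<eta> * LM\<^sup>2) * expectation (\<lambda>\<omega>. (norm (xs \<omega>))\<^sup>2)
      + 2 * \<eta> / real T * (\<Sum>t=1..T. Lc\<^sup>2) + 2 * \<eta> / real T * (\<Sum>t=1..T. Lb\<^sup>2)"
    using \<eta> by (intro add_mono mult_left_mono order_refl Nc Nb) auto
  also have "\<dots> = (1 / (\<eta> * real T) + 2 * \<eta> * LM\<^sup>2) * D + 2 * \<eta> * (Lb\<^sup>2 + Lc\<^sup>2)"
    using T int by (simp add: D_def field_simps)
  \<comment> \<open>From \<open>r * r = LM\<^sup>2 * real T\<close>, which trades
    \<open>1 / real T\<close> for \<open>LM\<^sup>2 / (r * r)\<close>.\<close>
  also have "1 / (\<eta> * real T) = sqrt 2 * LM\<^sup>2 / r"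
    using T r r2 by (simp add: \<eta>r field_simps)
  also have "(sqrt 2 * LM\<^sup>2 / r + 2 * \<eta> * LM\<^sup>2) * D + 2 * \<eta> * (Lb\<^sup>2 + Lc\<^sup>2)
      = 2 * sqrt 2 * (LM\<^sup>2 * D / r) + sqrt 2 * ((Lb\<^sup>2 + Lc\<^sup>2) / r)"
    unfolding \<eta>2 by (simp add: field_simps)
  \<comment> \<open>The noise terms carry only \<open>sqrt 2\<close>; it is doubled to share one
    constant with the comparator term.\<close>
  also have "\<dots> \<le> 2 * sqrt 2 * (LM\<^sup>2 * D / r) + 2 * sqrt 2 * ((Lb\<^sup>2 + Lc\<^sup>2) / r)"
    using r by (intro add_left_mono mult_right_mono) auto
  also have "\<dots> = 2 * sqrt 2 * ((LM\<^sup>2 * D + Lb\<^sup>2 + Lc\<^sup>2) / r)"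
    by (simp add: add_divide_distrib distrib_left)
  finally show ?thesis unfolding D_def r_def .
qed

end

theorem theorem3p1:
  fixes P :: "'w measure" and T :: nat
    and M :: "real ^ 'n ^ 'm" and b :: "real ^ 'm" and c :: "real ^ 'n"
    and \<xi>M Mh :: "nat \<Rightarrow> 'w \<Rightarrow> real ^ 'n ^ 'm"
    and \<xi>b bh :: "nat \<Rightarrow> 'w \<Rightarrow> real ^ 'm"
    and \<xi>c ch :: "nat \<Rightarrow> 'w \<Rightarrow> real ^ 'n"
    and LM Lb Lc :: real
  assumes "T \<ge> 1"
    and "cogda_noise P T M b c \<xi>M \<xi>b \<xi>c Mh bh ch LM Lb Lc"
  shows
    "(\<forall>\<eta>x>0. \<forall>\<eta>y>0. \<forall>x1 y1 xs ys. adaptive_comparator P x1 y1 xs ys \<longrightarrow>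
        (let \<rho>x = 4 * \<eta>y * LM\<^sup>2;
             \<rho>y = 4 * \<eta>x * LM\<^sup>2;
             G = (\<lambda>\<omega>. cogda_gap M b c \<eta>x \<eta>y \<rho>x \<rho>y x1 y1
                        (\<lambda>t. Mh t \<omega>) (\<lambda>t. bh t \<omega>) (\<lambda>t. ch t \<omega>) T (xs \<omega>) (ys \<omega>))
         in integrable P G \<and>
            (\<integral>\<omega>. G \<omega> \<partial>P)
              \<le> (1 / (\<eta>y * real T) + 2 * \<eta>x * LM\<^sup>2) * (\<integral>\<omega>. (norm (ys \<omega> - y1))\<^sup>2 \<partial>P)
                + (1 / (\<eta>x * real T) + 2 * \<eta>y * LM\<^sup>2) * (\<integral>\<omega>. (norm (xs \<omega> - x1))\<^sup>2 \<partial>P)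
                + 2 * \<eta>y / real T *
                    (\<Sum>t=1..T. \<integral>\<omega>. (norm (transpose (Mh t \<omega>) *v x1 - ch t \<omega>))\<^sup>2 \<partial>P)
                + 2 * \<eta>x / real T *
                    (\<Sum>t=1..T. \<integral>\<omega>. (norm (Mh t \<omega> *v y1 + bh t \<omega>))\<^sup>2 \<partial>P)))
   \<and> (\<forall>xs ys. adaptive_comparator P 0 0 xs ys \<longrightarrow>
        (let \<eta> = 1 / (LM * sqrt (2 * real T));
             \<rho> = 4 * \<eta> * LM\<^sup>2;
             G = (\<lambda>\<omega>. cogda_gap M b c \<eta> \<eta> \<rho> \<rho> 0 0
                        (\<lambda>t. Mh t \<omega>) (\<lambda>t. bh t \<omega>) (\<lambda>t. ch t \<omega>) T (xs \<omega>) (ys \<omega>))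
         in (\<integral>\<omega>. G \<omega> \<partial>P)
              \<le> 2 * sqrt 2 *
                 ((LM\<^sup>2 * (\<integral>\<omega>. (norm (ys \<omega>))\<^sup>2 + (norm (xs \<omega>))\<^sup>2 \<partial>P) + Lb\<^sup>2 + Lc\<^sup>2)
                  / (LM * sqrt (real T)))))"
proof -
  interpret cogda_noise P T M b c \<xi>M \<xi>b \<xi>c Mh bh ch LM Lb Lc by fact
  show ?thesis
    unfolding Let_def
    using expected_gap_bound[OF assms(1)] expected_gap_bound_uniform_step[OF assms(1)]
    by blast
qed

end
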